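(* Let $N\ge 2$, $k,k_1>0$ and $k_2=(N-1)k+k_1+\frac12$. For a polynomial $f$ on $\mathbf{R}^N$ let $\mathrm{cof}(f,x_1^ax_2^b)$ denote the coefficient of the monomial $x_1^ax_2^b$ in the expansion of $f$ in monomials in $x_1,\dots,x_N$. For the polynomials $h_{n,\varepsilon}$ defined in the context and every $n=0,1,2,\dots$: $$\mathrm{cof}(h_{4n,0},x_1^{4n})=\mathrm{cof}(h_{4n,0},x_2^{4n})=h_{4n,0}(1,0,\dots,0)=\frac{(-1)^n(k+1)_n(k_2-k)_n((N-1)k+1)_n}{n!\,(k_2+n)_n(Nk+n+1)_n},$$ $$\mathrm{cof}(h_{4n+1,1},x_1^{4n+1}x_2)=\mathrm{cof}(h_{4n+1,1},x_1x_2^{4n+1})=\frac{(-1)^n(k+1)_n(k_2+1-k)_n((N-1)k+1)_n}{n!\,(k_2+n+1)_n(Nk+n+1)_n},$$ $$\mathrm{cof}(h_{4n+2,0},x_1^{4n+2})=-\mathrm{cof}(h_{4n+2,0},x_2^{4n+2})=h_{4n+2,0}(1,0,\dots,0)=\frac{(-1)^n(k+1)_n(k_2-k)_n((N-1)k+1)_n}{n!\,(k_2+n+1)_n(Nk+n+2)_n},$$ $$\mathrm{cof}(h_{4n+3,1},x_1^{4n+3}x_2)=-\mathrm{cof}(h_{4n+3,1},x_1x_2^{4n+3})=\frac{(-1)^n(k+1)_n(k_2+1-k)_n((N-1)k+1)_n}{n!\,(k_2+n+2)_n(Nk+n+2)_n},$$ $$\mathrm{cof}(h_{4n+1,0},x_1^{4n+1})=\frac{(-1)^n(k+1)_n(k_2-k)_n((N-1)k+1)_n}{n!\,(k_2+n+1)_n(Nk+n+1)_n},$$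 $$\mathrm{cof}(h_{4n+1,0},x_1x_2^{4n})=\mathrm{cof}(h_{4n+1,0},x_1^{4n+1})\,\frac{k_2-k+2n}{k_2-k},$$ $$\mathrm{cof}(h_{4n+3,0},x_1^{4n+3})=\frac{(-1)^{n+1}(k+1)_n(k_2-k)_{n+1}((N-1)k+1)_n}{n!\,(k_2+n+1)_{n+1}(Nk+n+2)_n},$$ $$\mathrm{cof}(h_{4n+3,0},x_1x_2^{4n+2})=-\mathrm{cof}(h_{4n+3,0},x_1^{4n+3})\,\frac{k_2+k+2n+1}{k_2-k}.$$
   Context: Pochhammer symbol: $(a)_0=1$, $(a)_j=a(a+1)\cdots(a+j-1)$. Generating functions ($x\in\mathbf{R}^N$): $$F_0(x;s,t)=\frac{1-st(x_1^2+x_2^2)+t^2x_1^2x_2^2}{(1-2stx_1^2+t^2x_1^4)(1-2stx_2^2+t^2x_2^4)}\prod_{i=1}^N(1-2stx_i^2+t^2x_i^4)^{-k},$$ $$F_1(x;s,t)=\frac{t(x_1^2-x_2^2)}{(1-2stx_1^2+t^2x_1^4)(1-2stx_2^2+t^2x_2^4)}\prod_{i=1}^N(1-2stx_i^2+t^2x_i^4)^{-k}.$$ The polynomials $\phi_{n,j},\psi_{n,j}$ ($0\le j\le n$) in $x$ are defined by the power series expansions $$\sum_{n=0}^\infty\sum_{j=0}^n\phi_{n,j}(x)s^jt^n=F_0+F_1,\qquad \sum_{n=0}^\infty\sum_{j=0}^n\psi_{n,j}(x)s^jt^n=x_1(F_0+sF_1)-x_1F_1 .$$ The polynomials $h_{n,\varepsilon}$: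 for $n=0,1,2,\dots$, $$h_{4n,0}=\sum_{j=0}^{n}\frac{(2(N-1)k+k_1+\frac12+2n)_j(\frac12)_j}{((N-1)k+k_1+\frac12+n)_j(Nk+n+1)_j}\phi_{2n,2j},$$ $$h_{4n+2,0}=\sum_{j=0}^{n}\frac{(2(N-1)k+k_1+\frac32+2n)_j(\frac12)_j}{((N-1)k+k_1+\frac32+n)_j(Nk+n+2)_j}\phi_{2n+1,2j},$$ $$h_{4n+1,1}=x_1x_2\sum_{j=0}^{n}\frac{(2(N-1)k+k_1+\frac32+2n)_j(\frac12)_j}{((N-1)k+k_1+\frac32+n)_j(Nk+n+1)_j}\phi_{2n,2j},$$ $$h_{4n+3,1}=x_1x_2\sum_{j=0}^{n}\frac{(2(N-1)k+k_1+\frac52+2n)_j(\frac12)_j}{((N-1)k+k_1+\frac52+n)_j(Nk+n+2)_j}\phi_{2n+1,2j},$$ $$h_{4n+1,0}=\sum_{j=0}^{n}\frac{(2(N-1)k+k_1+\frac32+2n)_j(\frac12)_j}{((N-1)k+k_1+\frac32+n)_j(Nk+n+1)_j}\psi_{2n,2j}+\sum_{j=1}^{n}\frac{(2(N-1)k+k_1+\frac32+2n)_{j-1}(\frac12)_j}{((N-1)k+k_1+\frac32+n)_{j-1}(Nk+n+1)_j}\psi_{2n,2j-1},$$ $$h_{4n+3,0}=\sum_{j=0}^{n}\frac{(2(N-1)k+k_1+\frac52+2n)_j(\frac12)_j}{((N-1)k+k_1+\frac32+n)_j(Nk+n+2)_j}\psi_{2n+1,2j}+\sum_{j=1}^{n+1}\frac{(2(N-1)k+k_1+\frac52+2n)_{j-1}(\frac12)_j}{((N-1)k+k_1+\frac32+n)_j(Nk+n+2)_{j-1}}\psi_{2n+1,2j-1}.$$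 *)

theory Defs
  imports
    "HOL-Library.Poly_Mapping"
    "HOL-Computational_Algebra.Polynomial"
    "HOL-Computational_Algebra.Formal_Power_Series"
begin

section \<open>Polynomials in the variables $x_1, x_2, \ldots$\<close>

text \<open>
  A monomial is a finitely supported exponent vector; the variable \<open>x_i\<close> has index \<open>i\<close>
  (so indices start at 1), and polynomials on \<open>R^N\<close> involve the indices \<open>1, ..., N\<close>.
\<close>

type_synonym mpol = "(nat \<Rightarrow>\<^sub>0 nat) \<Rightarrow>\<^sub>0 real"

definition Const :: "real \<Rightarrow> mpol" where
  "Const c = Poly_Mapping.single 0 c"

definition X :: "nat \<Rightarrow> mpol" where
  "X i = Poly_Mapping.single (Poly_Mapping.single i 1) 1"

definition eval :: "mpol \<Rightarrow> (nat \<Rightarrow> real) \<Rightarrow> real" where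
  "eval p x = (\<Sum>m\<in>Poly_Mapping.keys p.
     Poly_Mapping.lookup p m * (\<Prod>i\<in>Poly_Mapping.keys m. x i ^ Poly_Mapping.lookup m i))"

text \<open>\<open>cof p a b\<close> is the coefficient of \<open>x_1^a x_2^b\<close> in \<open>p\<close>.\<close>

definition cof :: "mpol \<Rightarrow> nat \<Rightarrow> nat \<Rightarrow> real" where
  "cof p a b = Poly_Mapping.lookup p (Poly_Mapping.single 1 a + Poly_Mapping.single 2 b)"


section \<open>Generating functions\<close>

text \<open>
  Power series in \<open>t\<close> whose coefficients are polynomials in \<open>s\<close> over the ring of polynomials
  in \<open>x\<close>.
\<close>

type_synonym gser = "mpol poly fps"

definition T :: gser where "T = fps_X"

definition S :: gser where "S = fps_const [:0, 1:]"

definition emb :: "mpol \<Rightarrow> gser" where "emb p = fps_const [:p:]"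

text \<open>
  Real powers of a series \<open>f\<close> whose constant term in \<open>t\<close> is 1, by the binomial series in
  \<open>f - 1\<close>.
\<close>

definition rpow :: "gser \<Rightarrow> real \<Rightarrow> gser" where
  "rpow f a = fps_compose (Abs_fps (\<lambda>j. [:Const (a gchoose j):])) (f - 1)"

definition Q :: "nat \<Rightarrow> gser" where
  "Q i = 1 - 2 * S * T * emb (X i ^ 2) + T ^ 2 * emb (X i ^ 4)"

definition F0 :: "nat \<Rightarrow> real \<Rightarrow> gser" where
  "F0 N k =
     (1 - S * T * emb (X 1 ^ 2 + X 2 ^ 2) + T ^ 2 * emb (X 1 ^ 2 * X 2 ^ 2))
       * rpow (Q 1) (-1) * rpow (Q 2) (-1) * (\<Prod>i=1..N. rpow (Q i) (- k))"

definition F1 :: "nat \<Rightarrow> real \<Rightarrow> gser" where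
  "F1 N k =
     T * emb (X 1 ^ 2 - X 2 ^ 2)
       * rpow (Q 1) (-1) * rpow (Q 2) (-1) * (\<Prod>i=1..N. rpow (Q i) (- k))"

definition phi :: "nat \<Rightarrow> real \<Rightarrow> nat \<Rightarrow> nat \<Rightarrow> mpol" where
  "phi N k n j = poly.coeff (fps_nth (F0 N k + F1 N k) n) j"

definition psi :: "nat \<Rightarrow> real \<Rightarrow> nat \<Rightarrow> nat \<Rightarrow> mpol" where
  "psi N k n j =
     poly.coeff (fps_nth (emb (X 1) * (F0 N k + S * F1 N k) - emb (X 1) * F1 N k) n) j"


text \<open>
  The exponent laws for \<open>rpow\<close>: in particular \<open>rpow f (-1)\<close> is the multiplicative inverse
  of \<open>f\<close>.
\<close>

lemma Const_add: "Const (a + b) = Const a + Const b"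
  by (simp add: Const_def single_add)

lemma Const_mult: "Const (a * b) = Const a * Const b"
  by (simp add: Const_def mult_single)

lemma Const_0: "Const 0 = 0" and Const_1: "Const 1 = 1"
  by (simp_all add: Const_def)

lemma Const_sum: "Const (sum g A) = (\<Sum>i\<in>A. Const (g i))"
  by (induction A rule: infinite_finite_induct) (simp_all add: Const_add Const_0)

lemma const_poly_sum: "[:sum g A:] = (\<Sum>i\<in>A. [:g i:])"
  by (rule poly_eqI) (simp add: coeff_sum coeff_pCons split: nat.split)

lemma rpow_add:
  assumes "fps_nth f 0 = 1"
  shows "rpow f (a + b) = rpow f a * rpow f b"
proof -
  have "Abs_fps (\<lambda>j. [:Const ((a + b) gchoose j):]) =
        Abs_fps (\<lambda>j. [:Const (a gchoose j):]) * Abs_fps (\<lambda>j. [:Const (b gchoose j):])"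
    by (rule fps_ext)
       (simp add: fps_mult_nth gbinomial_Vandermonde[symmetric] Const_sum const_poly_sum
          Const_mult atLeast0AtMost mult.commute)
  then show ?thesis
    unfolding rpow_def using assms by (simp add: fps_compose_mult_distrib)
qed

lemma rpow_0: "rpow f 0 = 1"
proof -
  have "Abs_fps (\<lambda>j. [:Const (0 gchoose j):]) = 1"
    by (rule fps_ext) (simp add: gbinomial_0_left Const_0 Const_1 one_pCons)
  then show ?thesis by (simp add: rpow_def)
qed

lemma rpow_1:
  assumes "fps_nth f 0 = 1"
  shows "rpow f 1 = f"
proof -
  have "Abs_fps (\<lambda>j. [:Const (1 gchoose j):]) = 1 + fps_X"
  proof (rule fps_ext)
    fix j
    have "(1::real) gchoose j = (if j \<le> 1 then 1 else 0)"
      using binomial_gbinomial[of 1 j, where ?'a = real] by (cases "j \<le> 1") (auto simp: le_Suc_eq binomial_eq_0)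
    then show "fps_nth (Abs_fps (\<lambda>j. [:Const (1 gchoose j):])) j = fps_nth (1 + fps_X) j"
      by (cases j) (auto simp: Const_0 Const_1 one_pCons)
  qed
  then show ?thesis
    using assms by (simp add: rpow_def fps_compose_add_distrib)
qed

lemma rpow_minus_1: "fps_nth f 0 = 1 \<Longrightarrow> f * rpow f (-1) = 1"
  using rpow_add[of f 1 "-1"] by (simp add: rpow_0 rpow_1)

lemma Q_nth_0: "fps_nth (Q i) 0 = 1"
  by (simp add: Q_def T_def S_def emb_def power2_eq_square)


section \<open>The polynomials $h_{n,\varepsilon}$\<close>

definition h_4n_0 :: "nat \<Rightarrow> real \<Rightarrow> real \<Rightarrow> nat \<Rightarrow> mpol" where
  "h_4n_0 N k k1 n =
    (\<Sum>j=0..n. Const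
       (pochhammer (2 * (real N - 1) * k + k1 + 1/2 + 2 * real n) j * pochhammer (1/2) j /
        (pochhammer ((real N - 1) * k + k1 + 1/2 + real n) j
          * pochhammer (real N * k + real n + 1) j))
       * phi N k (2 * n) (2 * j))"

definition h_4n2_0 :: "nat \<Rightarrow> real \<Rightarrow> real \<Rightarrow> nat \<Rightarrow> mpol" where
  "h_4n2_0 N k k1 n =
    (\<Sum>j=0..n. Const
       (pochhammer (2 * (real N - 1) * k + k1 + 3/2 + 2 * real n) j * pochhammer (1/2) j /
        (pochhammer ((real N - 1) * k + k1 + 3/2 + real n) j
          * pochhammer (real N * k + real n + 2) j))
       * phi N k (2 * n + 1) (2 * j))"

definition h_4n1_1 :: "nat \<Rightarrow> real \<Rightarrow> real \<Rightarrow> nat \<Rightarrow> mpol" where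
  "h_4n1_1 N k k1 n = X 1 * X 2 *
    (\<Sum>j=0..n. Const
       (pochhammer (2 * (real N - 1) * k + k1 + 3/2 + 2 * real n) j * pochhammer (1/2) j /
        (pochhammer ((real N - 1) * k + k1 + 3/2 + real n) j
          * pochhammer (real N * k + real n + 1) j))
       * phi N k (2 * n) (2 * j))"

definition h_4n3_1 :: "nat \<Rightarrow> real \<Rightarrow> real \<Rightarrow> nat \<Rightarrow> mpol" where
  "h_4n3_1 N k k1 n = X 1 * X 2 *
    (\<Sum>j=0..n. Const
       (pochhammer (2 * (real N - 1) * k + k1 + 5/2 + 2 * real n) j * pochhammer (1/2) j /
        (pochhammer ((real N - 1) * k + k1 + 5/2 + real n) j
          * pochhammer (real N * k + real n + 2) j))
       * phi N k (2 * n + 1) (2 * j))"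

definition h_4n1_0 :: "nat \<Rightarrow> real \<Rightarrow> real \<Rightarrow> nat \<Rightarrow> mpol" where
  "h_4n1_0 N k k1 n =
    (\<Sum>j=0..n. Const
       (pochhammer (2 * (real N - 1) * k + k1 + 3/2 + 2 * real n) j * pochhammer (1/2) j /
        (pochhammer ((real N - 1) * k + k1 + 3/2 + real n) j
          * pochhammer (real N * k + real n + 1) j))
       * psi N k (2 * n) (2 * j))
    + (\<Sum>j=1..n. Const
       (pochhammer (2 * (real N - 1) * k + k1 + 3/2 + 2 * real n) (j - 1) * pochhammer (1/2) j /
        (pochhammer ((real N - 1) * k + k1 + 3/2 + real n) (j - 1)
          * pochhammer (real N * k + real n + 1) j))
       * psi N k (2 * n) (2 * j - 1))"

text \<open>In the second sum of \<open>h_4n3_0\<close> the index shift by one sits on different factors than in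
  \<open>h_4n1_0\<close>.\<close>

definition h_4n3_0 :: "nat \<Rightarrow> real \<Rightarrow> real \<Rightarrow> nat \<Rightarrow> mpol" where
  "h_4n3_0 N k k1 n =
    (\<Sum>j=0..n. Const
       (pochhammer (2 * (real N - 1) * k + k1 + 5/2 + 2 * real n) j * pochhammer (1/2) j /
        (pochhammer ((real N - 1) * k + k1 + 3/2 + real n) j
          * pochhammer (real N * k + real n + 2) j))
       * psi N k (2 * n + 1) (2 * j))
    + (\<Sum>j=1..n+1. Const
       (pochhammer (2 * (real N - 1) * k + k1 + 5/2 + 2 * real n) (j - 1) * pochhammer (1/2) j /
        (pochhammer ((real N - 1) * k + k1 + 3/2 + real n) j
          * pochhammer (real N * k + real n + 2) (j - 1)))
       * psi N k (2 * n + 1) (2 * j - 1))"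


text \<open>The point \<open>(1, 0, ..., 0)\<close>.\<close>

definition e1 :: "nat \<Rightarrow> real" where
  "e1 i = (if i = 1 then 1 else 0)"

end

theory Submission
  imports Defs
begin

text \<open>
  Every coefficient in the statement is read off on a coordinate axis. A coefficient of
  \<open>x\<^sub>i\<^sup>a\<close> is unchanged when all variables except \<open>x\<^sub>i\<close> are set to 0, and a coefficient of
  \<open>x\<^sub>1 x\<^sub>2\<^sup>b\<close> becomes of that kind after a factor \<open>x\<^sub>1\<close> is split off; every
  \<open>\<psi>\<^sub>n\<^sub>,\<^sub>j\<close> has such a factor. Restriction to an axis is a ring homomorphism, and it collapses the
  generating functions: all factors \<open>1 - 2stx\<^sub>l\<^sup>2 + t\<^sup>2x\<^sub>l\<^sup>4\<close> with \<open>l \<noteq> i\<close> become 1, so that, with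
  \<open>y = x\<^sub>i\<^sup>2\<close>, what remains is \<open>(1 + \<alpha>ty + \<beta>sty) (1 - 2sty + t\<^sup>2y\<^sup>2)\<^sup>-\<^sup>k\<^sup>-\<^sup>1\<close>. The pair
  \<open>(\<alpha>, \<beta>)\<close> is \<open>(1, -1)\<close> and \<open>(-1, -1)\<close> for \<open>\<phi>\<close> on the first and second axis, and \<open>(-1, 0)\<close>
  and \<open>(1, -2)\<close> for the cofactor of \<open>x\<^sub>1\<close> in \<open>\<psi>\<close> (\<open>axis_phi\<close>, \<open>axis_psi_cofactor\<close>). The
  coefficients of the second factor are those of the Gegenbauer polynomials of
  order \<open>k + 1\<close> in \<open>s\<close>.

  In the definition of the \<open>h\<close> polynomials the factor \<open>(1/2)\<^sub>j\<close> cancels the one in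
  \<open>(2j)! = 4\<^sup>j j! (1/2)\<^sub>j\<close>, which leaves terminating hypergeometric sums
  \<open>\<^sub>3F\<^sub>2(-n, a, b; c, d; 1)\<close>. For \<open>\<beta> = -1\<close>, \<open>j\<close> even and \<open>n\<close> even two Gegenbauer coefficients combine
  into one product (\<open>gegenbauer_coeff_even_diff\<close>), for \<open>n\<close> odd only one contributes, and the sum
  satisfies the balance condition \<open>c + d = a + b - n + 1\<close> of the Pfaff--Saalschuetz theorem
  (\<open>saalschuetz\<close>). This settles the \<open>h\<close> built from \<open>\<phi>\<close>.

  For the \<open>h\<close> built from \<open>\<psi>\<close>, pairing the \<open>j\<close>-th terms of the two sums on the first axis gives
  such a sum with an additional factor linear in \<open>j\<close> and with \<open>c + d = a + b - n + 2\<close>; it is a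
  combination of two balanced sums (\<open>saalschuetz_next\<close>). On the second axis no further sum of this
  kind is needed: \<open>(1, -2) = 2 (0, -1) - (-1, 0)\<close>, and for \<open>(0, -1)\<close> one of the two sums
  vanishes and the other is balanced.
\<close>

section \<open>The Pfaff--Saalschuetz sum\<close>

text \<open>
  The terms of \<open>\<^sub>3F\<^sub>2(-n, a, b; c, d; 1)\<close>, with \<open>(-n)\<^sub>j / j!\<close> written as a signed binomial
  coefficient.
\<close>

definition hyp_term :: "nat \<Rightarrow> 'a \<Rightarrow> 'a \<Rightarrow> 'a \<Rightarrow> 'a \<Rightarrow> nat \<Rightarrow> 'a::field_char_0" where
  "hyp_term n a b c d j =
     (-1)^j * of_nat (n choose j) * pochhammer a j * pochhammer b j / (pochhammer c j * pochhammer d j)"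

lemma pochhammer_shift:
  fixes b :: "'a::comm_semiring_1"
  shows "b * pochhammer (b + 1) j = pochhammer b j * (b + of_nat j)"
  using pochhammer_rec[of b j] pochhammer_Suc[of b j] by simp

lemma of_nat_choose_Suc: "(of_nat (j + 1) :: 'a::field_char_0) * of_nat (n choose (j + 1)) = (of_nat n - of_nat j) * of_nat (n choose j)"
proof (cases "j \<le> n")
  case True
  have "Suc j * (n choose Suc j) = (n - j) * (n choose j)"
    using binomial_absorb_comp[of n j] Suc_times_binomial_eq[of "n-1" j] True
    by (cases n) (auto simp: binomial_absorption)
  then have "(of_nat (Suc j * (n choose Suc j)) :: 'a) = of_nat ((n - j) * (n choose j))" by simp
  then show ?thesis using True by (simp add: of_nat_diff algebra_simps)
qed (simp add: binomial_eq_0)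

text \<open>
  The polynomial identity behind the telescoping recurrence in \<open>saalschuetz\<close>, with \<open>M = n\<close> and
  \<open>j = i + 1\<close>. It holds because the bracket on the right is linear in \<open>i\<close>: its cubic part
  cancels, and its quadratic part cancels by the balance condition.
\<close>

lemma saalschuetz_certificate:
  fixes a c d M i:: "'a::field_char_0"
  defines "b \<equiv> c + d - a + M - 1"
  shows "(M+1)*(b+(i+1))*(c+M)*(d+M) - (M-i)*b*(c+M-a)*(d+M-a)
    = (b+M+1)*((M-i)*(a+(i+1))*(b+(i+1)) + (i+1)*(c+i)*(d+i))"
  unfolding b_def by algebra

text \<open>
  The sum over \<open>j\<close> of the terms for \<open>n + 1\<close> is \<open>r\<close> times the sum for \<open>n\<close>, where \<open>r\<close> is the quotient of
  the corresponding right-hand sides. This is creative telescoping in the manner of Wilf and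
  Zeilberger: the difference of the terms is \<open>G (j + 1) - G j\<close> with \<open>G\<close> a rational multiple of
  the term. The parameter \<open>b\<close> goes up by one with \<open>n\<close>, as the balance condition requires. The terms
  are not divided by the right-hand side beforehand, because it may vanish.
\<close>

lemma saalschuetz:
  fixes a c d :: "'a::field_char_0"
  assumes "pochhammer c n \<noteq> 0" "pochhammer d n \<noteq> 0"
  shows "(\<Sum>j\<le>n. hyp_term n a (c + d - a + of_nat n - 1) c d j) =
    pochhammer (c - a) n * pochhammer (d - a) n / (pochhammer c n * pochhammer d n)"
  using assms
proof (induction n)
  case 0
  then show ?case by (simp add: hyp_term_def)
next
  case (Suc n)
  define M :: 'a where "M = of_nat n"
  define b where "b = c + d - a + M - 1"
  have nz: "pochhammer c n \<noteq> 0" "pochhammer d n \<noteq> 0" and nzc: "c + M \<noteq> 0" "d + M \<noteq> 0"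
    using Suc.prems by (auto simp: pochhammer_Suc M_def)
  define r where "r = (c - a + M) * (d - a + M) / ((c + M) * (d + M))"
  \<comment> \<open>The factor \<open>b + M + 1\<close> is forced by the case \<open>j = 0\<close>, where \<open>G 1\<close> must be \<open>1 - r\<close>.\<close>
  define G where "G j = (case j of 0 \<Rightarrow> 0 | Suc i \<Rightarrow>
     (b + M + 1) * (-1)^i * of_nat (n choose i) * pochhammer a (Suc i) * pochhammer (b + 1) i
      / (pochhammer c i * pochhammer d i * ((c + M) * (d + M))))" for j
  have step: "hyp_term (Suc n) a (b + 1) c d j - r * hyp_term n a b c d j = G (Suc j) - G j"
    if "j \<le> Suc n" for j
  proof (cases j)
    case 0
    have "1 - r = (b + M + 1) * a / ((c + M) * (d + M))"
    proof -
      have "(c + M) * (d + M) - (c - a + M) * (d - a + M) = (b + M + 1) * a"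
        unfolding b_def by algebra
      moreover have "1 - r = ((c + M) * (d + M) - (c - a + M) * (d - a + M)) / ((c + M) * (d + M))"
        using nzc by (simp add: r_def diff_divide_distrib)
      ultimately show ?thesis by simp
    qed
    then show ?thesis using 0 by (simp add: hyp_term_def G_def)
  next
    case (Suc i)
    have i: "i \<le> n" using that Suc by simp
    have ci: "pochhammer c i \<noteq> 0" "pochhammer d i \<noteq> 0"
      using nz i pochhammer_neq_0_mono by blast+
    have cj: "c + of_nat i \<noteq> 0" "d + of_nat i \<noteq> 0"
      using pochhammer_neq_0_mono[OF Suc.prems(1), of "Suc i"]
        pochhammer_neq_0_mono[OF Suc.prems(2), of "Suc i"] i by (auto simp: pochhammer_Suc)
    define I :: 'a where "I = of_nat i"
    have I1: "I + 1 \<noteq> 0" unfolding I_def by (metis of_nat_Suc add.commute of_nat_eq_0_iff nat.distinct(1))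
    have c1: "of_nat (n choose Suc i) = (M - I) * of_nat (n choose i) / (I + 1)"
      using of_nat_choose_Suc[of i n, where ?'a = 'a] I1
      by (simp add: M_def I_def field_simps)
    have c2: "of_nat (Suc n choose Suc i) = (M + 1) * of_nat (n choose i) / (I + 1)"
      using c1 I1 by (simp add: field_simps)
    define u where "u = (-1)^i * of_nat (n choose i) * pochhammer a (Suc i) * pochhammer (b + 1) i
      / (pochhammer c i * pochhammer d i)"
    have b0: "b * pochhammer (b + 1) i = pochhammer b (Suc i)" by (simp add: pochhammer_rec)
    have t1: "hyp_term (Suc n) a (b + 1) c d j = - u * (M + 1) * (b + (I + 1)) / ((I + 1) * (c + I) * (d + I))"
      using ci cj I1 unfolding Suc hyp_term_def c2 u_def pochhammer_Suc[of "b+1"]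
      by (simp add: pochhammer_Suc[of c] pochhammer_Suc[of d] I_def[symmetric]
          divide_inverse ac_simps)
    have t2: "hyp_term n a b c d j = - u * (M - I) * b / ((I + 1) * (c + I) * (d + I))"
      using ci cj I1 unfolding Suc hyp_term_def c1 u_def b0[symmetric]
      by (simp add: pochhammer_Suc[of c] pochhammer_Suc[of d] I_def[symmetric] divide_inverse ac_simps)
    have g1: "G j = (b + M + 1) * u / ((c + M) * (d + M))"
      by (simp add: G_def Suc u_def)
    have g2: "G (Suc j) = - ((b + M + 1) * u * (M - I) * (a + (I + 1)) * (b + (I + 1))
        / ((I + 1) * (c + I) * (d + I) * ((c + M) * (d + M))))"
      using ci cj I1 unfolding Suc G_def u_def nat.case c1 pochhammer_Suc[of "b+1"] pochhammer_Suc[of a "Suc i"]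
      by (simp add: pochhammer_Suc[of c] pochhammer_Suc[of d] I_def[symmetric] divide_inverse ac_simps)
    define P where "P = (I + 1) * (c + I) * (d + I)"
    define R where "R = (c + M) * (d + M)"
    have nzP: "P \<noteq> 0" "R \<noteq> 0" using cj I1 nzc by (auto simp: P_def R_def I_def)
    have "hyp_term (Suc n) a (b + 1) c d j - r * hyp_term n a b c d j
      = - u * ((M + 1) * (b + (I + 1)) * (c + M) * (d + M)
           - (M - I) * b * (c + M - a) * (d + M - a)) / (P * R)"
      unfolding t1 t2 r_def P_def[symmetric] R_def[symmetric] using nzP
      by (simp add: field_simps) (simp add: R_def algebra_simps)
    also have "\<dots> = - u * ((b+M+1)*((M-I)*(a+(I+1))*(b+(I+1)) + (I+1)*(c+I)*(d+I))) / (P * R)"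
      unfolding b_def saalschuetz_certificate ..
    also have "\<dots> = G (Suc j) - G j"
      unfolding g1 g2 P_def[symmetric] R_def[symmetric] using nzP
      by (simp add: field_simps)
    finally show ?thesis .
  qed
  have "(\<Sum>j\<le>Suc n. hyp_term (Suc n) a (b + 1) c d j) - r * (\<Sum>j\<le>Suc n. hyp_term n a b c d j)
      = (\<Sum>j\<le>Suc n. G (Suc j) - G j)"
    unfolding sum_distrib_left sum_subtractf[symmetric] by (intro sum.cong refl step) simp
  also have "\<dots> = G (Suc (Suc n)) - G 0"
    using sum_telescope''[of 0 "Suc n" ] by (simp add: sum_lessThan_telescope lessThan_Suc_atMost[symmetric])
  also have "\<dots> = 0" by (simp add: G_def binomial_eq_0)
  finally have "(\<Sum>j\<le>Suc n. hyp_term (Suc n) a (b + 1) c d j) = r * (\<Sum>j\<le>Suc n. hyp_term n a b c d j)"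
    by simp
  also have "(\<Sum>j\<le>Suc n. hyp_term n a b c d j) = (\<Sum>j\<le>n. hyp_term n a b c d j)"
    by (simp add: hyp_term_def binomial_eq_0)
  also have "\<dots> = pochhammer (c - a) n * pochhammer (d - a) n / (pochhammer c n * pochhammer d n)"
    using Suc.IH[OF nz] by (simp add: b_def M_def)
  finally have "(\<Sum>j\<le>Suc n. hyp_term (Suc n) a (b + 1) c d j) =
    r * (pochhammer (c - a) n * pochhammer (d - a) n / (pochhammer c n * pochhammer d n))" .
  moreover have "b + 1 = c + d - a + of_nat (Suc n) - 1"
    by (simp add: b_def M_def)
  ultimately show ?case
    unfolding r_def pochhammer_Suc M_def by (simp only: times_divide_times_eq mult_ac)
qed

text \<open>
  A sum off balance by one, with a linear factor. Writing
  \<open>p + qj = p/(c-1) (c-1+j) + (q - p/(c-1)) j\<close>, the first part lowers \<open>c\<close> by one and the second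
  shifts \<open>j\<close> (raising all of \<open>a\<close>, \<open>b\<close>, \<open>c\<close>, \<open>d\<close> and lowering \<open>n\<close>); both restore
  the balance. The upper index is written \<open>m + 1\<close> because the value has \<open>m\<close> factors
  \<open>c - a + i\<close> and \<open>d - a + i\<close>.
\<close>

lemma saalschuetz_next:
  fixes a b c d p q :: "'a::field_char_0"
  assumes nz: "pochhammer (c - 1) (Suc (Suc m)) \<noteq> 0" "pochhammer d (Suc m) \<noteq> 0"
    and b: "b = c + d - a + of_nat m - 1"
  shows "(\<Sum>j\<le>Suc m. hyp_term (Suc m) a b c d j * (p + q * of_nat j)) =
    pochhammer (c - a) m * pochhammer (d - a) m / (pochhammer c (Suc m) * pochhammer d (Suc m))
      * (p * ((c - a + of_nat m) * (d - a + of_nat m) + (of_nat m + 1) * a) - q * (of_nat m + 1) * a * b)"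
proof -
  define n where "n = Suc m"
  define M :: 'a where "M = of_nat m"
  have c1: "c - 1 \<noteq> 0" and cn: "pochhammer c (Suc m) \<noteq> 0" and cM: "c + M \<noteq> 0"
    using nz(1)[unfolded pochhammer_rec[of "c - 1"]] by (simp_all add: pochhammer_Suc M_def)
  have d0: "d \<noteq> 0" and c0: "c \<noteq> 0"
    using nz(2) cn by (simp_all add: pochhammer_rec)
  have d1: "pochhammer (d + 1) m \<noteq> 0" "pochhammer (c + 1) m \<noteq> 0"
    using nz(2) cn by (simp_all add: pochhammer_rec)
  have n1: "pochhammer (c - 1) n \<noteq> 0"
    using pochhammer_neq_0_mono[OF nz(1), of n] by (simp add: n_def)
  have A: "(\<Sum>j\<le>n. hyp_term n a b c d j * (c - 1 + of_nat j)) =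
     (c - 1) * (pochhammer (c - 1 - a) n * pochhammer (d - a) n / (pochhammer (c - 1) n * pochhammer d n))"
  proof -
    have "hyp_term n a b c d j * (c - 1 + of_nat j) = (c - 1) * hyp_term n a b (c - 1) d j" if "j \<le> n" for j
    proof -
      have "pochhammer (c - 1) (Suc j) \<noteq> 0"
        using pochhammer_neq_0_mono[OF nz(1), of "Suc j"] that by (simp add: n_def)
      then have x: "pochhammer (c - 1) j \<noteq> 0" "c - 1 + of_nat j \<noteq> 0" by (auto simp: pochhammer_Suc)
      have "pochhammer c j = pochhammer (c - 1) j * (c - 1 + of_nat j) / (c - 1)"
        using pochhammer_shift[of "c - 1" j] c1 by (simp add: field_simps)
      then show ?thesis using x c1 by (simp add: hyp_term_def)
    qed
    then have "(\<Sum>j\<le>n. hyp_term n a b c d j * (c - 1 + of_nat j)) = (c - 1) * (\<Sum>j\<le>n. hyp_term n a b (c - 1) d j)"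
      by (simp add: sum_distrib_left)
    also have "b = (c - 1) + d - a + of_nat n - 1" by (simp add: b n_def)
    then show ?thesis
      using saalschuetz[OF n1, of d a] nz(2) calculation by (simp add: n_def)
  qed
  have B: "(\<Sum>j\<le>n. hyp_term n a b c d j * of_nat j) =
     - (of_nat n * a * b / (c * d)) * (pochhammer (c - a) m * pochhammer (d - a) m / (pochhammer (c + 1) m * pochhammer (d + 1) m))"
  proof -
    have "hyp_term n a b c d (Suc j) * of_nat (Suc j)
        = - (of_nat n * a * b / (c * d)) * hyp_term m (a + 1) (b + 1) (c + 1) (d + 1) j" for j
    proof -
      have "of_nat (Suc j) * (of_nat (n choose Suc j)::'a) = of_nat n * of_nat (m choose j)"
        unfolding n_def of_nat_mult[symmetric] by (metis Suc_times_binomial)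
      then have e: "of_nat (n choose Suc j) * (of_nat (Suc j)::'a) = of_nat n * of_nat (m choose j)"
        by (simp only: mult.commute)
      have "hyp_term n a b c d (Suc j) * of_nat (Suc j) = (of_nat (n choose Suc j) * (of_nat (Suc j)::'a)) *
        ((-1)^Suc j * (a * pochhammer (a+1) j) * (b * pochhammer (b+1) j) / (c * pochhammer (c+1) j * (d * pochhammer (d+1) j)))"
        unfolding hyp_term_def pochhammer_rec by (simp del: of_nat_Suc)
      then show ?thesis unfolding e hyp_term_def by (simp add: divide_inverse ac_simps)
    qed
    then have "(\<Sum>j\<le>n. hyp_term n a b c d j * of_nat j)
      = - (of_nat n * a * b / (c * d)) * (\<Sum>j\<le>m. hyp_term m (a + 1) (b + 1) (c + 1) (d + 1) j)"
      unfolding n_def sum.atMost_Suc_shift by (simp add: sum_distrib_left del: of_nat_Suc)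
    also have "b + 1 = (c + 1) + (d + 1) - (a + 1) + of_nat m - 1" by (simp add: b)
    then have "(\<Sum>j\<le>m. hyp_term m (a + 1) (b + 1) (c + 1) (d + 1) j) =
      (pochhammer (c - a) m * pochhammer (d - a) m / (pochhammer (c + 1) m * pochhammer (d + 1) m))"
      using saalschuetz[OF d1(2,1), of "a+1"] by simp
    finally show ?thesis .
  qed
  have "hyp_term n a b c d j * (p + q * of_nat j) = p / (c - 1) * (hyp_term n a b c d j * (c - 1 + of_nat j))
     + (q - p / (c - 1)) * (hyp_term n a b c d j * of_nat j)" for j
  proof -
    define e where "e = p / (c - 1)"
    have "p = e * (c - 1)" using c1 by (simp add: e_def)
    then show ?thesis unfolding e_def[symmetric] by algebra
  qed
  then have "(\<Sum>j\<le>n. hyp_term n a b c d j * (p + q * of_nat j)) =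
     p / (c - 1) * (\<Sum>j\<le>n. hyp_term n a b c d j * (c - 1 + of_nat j))
     + (q - p / (c - 1)) * (\<Sum>j\<le>n. hyp_term n a b c d j * of_nat j)"
    by (simp add: sum.distrib sum_distrib_left)
  also have "\<dots> = p * (pochhammer (c - 1 - a) n * pochhammer (d - a) n / (pochhammer (c - 1) n * pochhammer d n))
     - (q - p / (c - 1)) * ((of_nat n * a * b / (c * d)) * (pochhammer (c - a) m * pochhammer (d - a) m / (pochhammer (c + 1) m * pochhammer (d + 1) m)))"
    unfolding A B using c1 by simp
  also have "pochhammer (c - 1 - a) n = (c - 1 - a) * pochhammer (c - a) m"
    by (simp add: n_def pochhammer_rec)
  also have "pochhammer (d - a) n = pochhammer (d - a) m * (d - a + M)"
    by (simp add: n_def pochhammer_Suc M_def)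
  also have "pochhammer (c - 1) n = pochhammer c n * (c - 1) / (c + M)"
    using pochhammer_shift[of "c - 1" n] cM by (simp add: field_simps n_def M_def)
  also have "pochhammer (c + 1) m = pochhammer c n / c" using c0 by (simp add: n_def pochhammer_rec)
  also have "pochhammer (d + 1) m = pochhammer d n / d" using d0 by (simp add: n_def pochhammer_rec)
  also have "p * ((c - 1 - a) * pochhammer (c - a) m * (pochhammer (d - a) m * (d - a + M)) /
         (pochhammer c n * (c - 1) / (c + M) * pochhammer d n)) -
    (q - p / (c - 1)) *
    (of_nat n * a * b / (c * d) * (pochhammer (c - a) m * pochhammer (d - a) m / (pochhammer c n / c * (pochhammer d n / d))))
    = pochhammer (c - a) m * pochhammer (d - a) m / (pochhammer c n * pochhammer d n) *
      (p * (((c - 1 - a) * (d - a + M) * (c + M) + (M + 1) * a * b) / (c - 1)) - q * (M + 1) * a * b)"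
    using c0 d0 c1 cn nz(2) unfolding n_def[symmetric]
    by (simp add: divide_simps n_def M_def) (simp add: algebra_simps)
  also have "(c - 1 - a) * (d - a + M) * (c + M) + (M + 1) * a * b = (c - 1) * ((c - a + M) * (d - a + M) + (M + 1) * a)"
    unfolding b M_def[symmetric] by algebra
  finally show ?thesis using c1 by (simp add: n_def M_def)
qed

section \<open>Gegenbauer coefficients of the binomial series\<close>

text \<open>
  The coefficient of \<open>s\<^sup>j t\<^sup>n\<close> in \<open>(1 - 2st + t\<^sup>2)\<^sup>a\<close>; for \<open>a = -\<lambda>\<close> it belongs to the Gegenbauer
  polynomial of order \<open>\<lambda>\<close>. Only the power \<open>(t\<^sup>2 - 2st)\<^sup>p\<close> with \<open>2p = n + j\<close> contributes to it.
\<close>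

definition gegenbauer_coeff :: "real \<Rightarrow> nat \<Rightarrow> nat \<Rightarrow> real" where
  "gegenbauer_coeff a n j = (if even (n + j) then
     (a gchoose ((n + j) div 2)) * of_nat ((n + j) div 2 choose j) * (-2)^j else 0)"

lemma linear_power_nth [simp]: "fps_nth ((fps_const u + fps_X * fps_const v) ^ p) m = of_nat (p choose m) * v ^ m * u ^ (p - m)"
  for u v :: "'a::comm_ring_1"
proof -
  have "(fps_const u + fps_X * fps_const v) ^ p = (fps_X * fps_const v + fps_const u) ^ p"
    by (simp add: add.commute)
  also have "\<dots> = (\<Sum>i\<le>p. fps_const (of_nat (p choose i) * v ^ i * u ^ (p - i)) * fps_X ^ i)"
    unfolding binomial_ring
    by (intro sum.cong refl)
       (simp add: power_mult_distrib fps_const_power fps_const_mult[symmetric] fps_of_nat[symmetric] mult_ac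
         del: fps_const_mult)
  finally show ?thesis
    by (simp add: fps_sum_nth if_distrib binomial_eq_0 cong: if_cong)
qed

lemma Const_power: "Const (c ^ n) = Const c ^ n"
  by (induction n) (simp_all add: Const_1 Const_mult)

lemma Const_of_nat: "Const (of_nat n) = of_nat n"
  by (induction n) (simp_all add: Const_0 Const_1 Const_add)

text \<open>
  The series is homogeneous, as \<open>t\<close> only occurs together with \<open>x\<^sub>i\<^sup>2\<close>.
\<close>

lemma coeff_rpow_Q:
  "poly.coeff (fps_nth (rpow (Q i) a) n) j = Const (gegenbauer_coeff a n j) * X i ^ (2 * n)"
proof -
  define u :: "mpol poly" where "u = monom (- (2 * X i ^ 2)) 1"
  define v :: "mpol poly" where "v = monom (X i ^ 4) 0"
  have Q: "Q i - 1 = fps_X * (fps_const u + fps_X * fps_const v)"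
  proof -
    have "2 * S * T * emb (X i ^ 2) = fps_X * fps_const (- u)"
    proof -
      have eq: "2 * (fps_const [:0, 1:] * fps_const [:X i ^ 2:]) = fps_const (- u)"
        unfolding mult_2 by (simp add: u_def monom_Suc monom_0)
      then show ?thesis
        unfolding S_def T_def emb_def eq[symmetric] by (simp only: mult_ac)
    qed
    then show ?thesis
      unfolding Q_def v_def emb_def T_def monom_0 fps_const_neg[symmetric]
      by (simp add: power2_eq_square algebra_simps del: fps_const_neg)
  qed
  have nth: "fps_nth ((Q i - 1) ^ p) n = (if p \<le> n then of_nat (p choose (n - p)) * v ^ (n - p) * u ^ (p - (n - p)) else 0)" for p
    unfolding Q power_mult_distrib by (simp add: fps_X_power_mult_nth)
  have mon: "[:Const c:] * (of_nat (p choose (n - p)) * v ^ (n - p) * u ^ (p - (n - p)))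
     = (if n \<le> 2 * p then monom (Const (c * of_nat (p choose (2 * p - n)) * (-2)^(2 * p - n)) * X i ^ (2 * n)) (2 * p - n) else 0)"
    if "p \<le> n" for p c
  proof (cases "n \<le> 2 * p")
    case True
    have e: "p - (n - p) = 2 * p - n" using that by simp
    have "u = monom (Const (-2) * X i ^ 2) 1"
      unfolding u_def Const_def single_uminus by simp
    then have u: "u ^ (2 * p - n) = monom (Const ((-2)^(2*p-n)) * X i ^ (2 * (2 * p - n))) (2 * p - n)"
      by (simp add: monom_power power_mult_distrib Const_power power_mult)
    have v: "v ^ (n - p) = monom (X i ^ (4 * (n - p))) 0"
      by (simp add: v_def monom_power power_mult)
    have b: "(of_nat (p choose (n - p)) :: mpol poly) = monom (Const (of_nat (p choose (n - p)))) 0"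
      by (simp add: monom_0 of_nat_poly Const_of_nat)
    have c: "p choose (n - p) = p choose (2 * p - n)"
      using binomial_symmetric[of "n - p" p] that True e by simp
    have d: "4 * (n - p) + 2 * (2 * p - n) = 2 * n" using True that by simp
    show ?thesis unfolding e u v b monom_0[symmetric] mult_monom d[symmetric] power_add Const_mult
      using True by (simp add: c mult_ac)
  qed (use that in \<open>simp add: binomial_eq_0\<close>)
  have "poly.coeff (fps_nth (rpow (Q i) a) n) j =
     (\<Sum>p=0..n. poly.coeff ([:Const (a gchoose p):] * fps_nth ((Q i - 1) ^ p) n) j)"
    unfolding rpow_def fps_compose_nth by (simp add: coeff_sum)
  also have "\<dots> = (\<Sum>p=0..n. if n + j = 2 * p then Const (gegenbauer_coeff a n j) * X i ^ (2 * n) else 0)"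
  proof (intro sum.cong refl)
    fix p assume "p \<in> {0..n}"
    then have p: "p \<le> n" by simp
    show "poly.coeff ([:Const (a gchoose p):] * fps_nth ((Q i - 1) ^ p) n) j =
        (if n + j = 2 * p then Const (gegenbauer_coeff a n j) * X i ^ (2 * n) else 0)"
      unfolding nth if_P[OF p] mon[OF p] by (auto simp: gegenbauer_coeff_def)
  qed
  also have "\<dots> = Const (gegenbauer_coeff a n j) * X i ^ (2 * n)"
  proof (cases "even (n + j)")
    case True
    then obtain q where q: "n + j = 2 * q" by (elim evenE)
    show ?thesis
    proof (cases "q \<le> n")
      case False
      then have "q < j" using q by simp
      then have "gegenbauer_coeff a n j = 0" by (simp add: gegenbauer_coeff_def q binomial_eq_0)
      then show ?thesis by (simp add: Const_0 cong: if_cong)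
    qed (simp add: q)
  next
    case False
    then have "n + j \<noteq> 2 * p" for p by (metis dvd_triv_left)
    moreover have "gegenbauer_coeff a n j = 0" using False by (simp add: gegenbauer_coeff_def)
    ultimately show ?thesis by (simp add: Const_0)
  qed
  finally show ?thesis .
qed

section \<open>Restriction to a coordinate axis\<close>

text \<open>
  The polynomial obtained by setting all variables but \<open>x\<^sub>i\<close> to 0.
\<close>

definition axis :: "nat \<Rightarrow> mpol \<Rightarrow> real poly" where
  "axis i p = Abs_poly (\<lambda>a. Poly_Mapping.lookup p (Poly_Mapping.single i a))"

lemma coeff_axis: "poly.coeff (axis i p) a = Poly_Mapping.lookup p (Poly_Mapping.single i a)"
proof -
  have "finite (Poly_Mapping.single i -` Poly_Mapping.keys p)"
    by (intro finite_vimageI) auto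
  then have "MOST a. Poly_Mapping.lookup p (Poly_Mapping.single i a) = 0"
    unfolding MOST_iff_cofinite
    by (rule rev_finite_subset) (auto simp: in_keys_iff)
  then show ?thesis by (simp add: axis_def Abs_poly_inverse)
qed

lemma axis_add: "axis i (p + q) = axis i p + axis i q"
  and axis_diff: "axis i (p - q) = axis i p - axis i q"
  and axis_0: "axis i 0 = 0"
  by (auto intro!: poly_eqI simp: coeff_axis lookup_add lookup_minus)

lemma axis_sum: "axis i (sum f A) = (\<Sum>x\<in>A. axis i (f x))"
  by (induction A rule: infinite_finite_induct) (auto simp: axis_add axis_0)

lemma keys_subset_singleton_iff:
  fixes m :: "nat \<Rightarrow>\<^sub>0 nat"
  shows "Poly_Mapping.keys m \<subseteq> {i} \<longleftrightarrow> m = Poly_Mapping.single i (Poly_Mapping.lookup m i)"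
proof
  assume "Poly_Mapping.keys m \<subseteq> {i}"
  then show "m = Poly_Mapping.single i (Poly_Mapping.lookup m i)"
    by (intro poly_mapping_eqI) (auto simp: lookup_single when_def in_keys_iff)
qed (metis keys_single empty_subsetI order_refl)

lemma axis_single:
  "axis i (Poly_Mapping.single m c) =
     (if Poly_Mapping.keys m \<subseteq> {i} then monom c (Poly_Mapping.lookup m i) else 0)"
  by (rule poly_eqI)
     (auto simp: coeff_axis lookup_single when_def keys_subset_singleton_iff)

lemma poly_mapping_sum_single: "p = (\<Sum>m\<in>Poly_Mapping.keys p. Poly_Mapping.single m (Poly_Mapping.lookup p m))"
  for p :: "'a \<Rightarrow>\<^sub>0 'b::comm_monoid_add"
  by (rule poly_mapping_eqI)
     (auto simp: lookup_sum lookup_single when_def in_keys_iff)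

text \<open>
  A sum of exponent vectors is supported on \<open>{i}\<close> only if both summands are, so no mixed monomial
  contributes to a pure power of \<open>x\<^sub>i\<close>.
\<close>

lemma axis_mult: "axis i (p * q) = axis i p * axis i q"
proof -
  have keys_add_nat: "Poly_Mapping.keys (l + m) = Poly_Mapping.keys l \<union> Poly_Mapping.keys m" for l m :: "nat \<Rightarrow>\<^sub>0 nat"
    by (auto simp: in_keys_iff lookup_add)
  have single: "axis i (Poly_Mapping.single l c * Poly_Mapping.single m d) =
      axis i (Poly_Mapping.single l c) * axis i (Poly_Mapping.single m d)" for l m c d
    by (simp add: mult_single axis_single keys_add_nat lookup_add mult_monom)
  define P where "P = (\<lambda>m. Poly_Mapping.single m (Poly_Mapping.lookup p m))"
  define R where "R = (\<lambda>m. Poly_Mapping.single m (Poly_Mapping.lookup q m))"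
  have p: "p = sum P (Poly_Mapping.keys p)" and q: "q = sum R (Poly_Mapping.keys q)"
    unfolding P_def R_def by (rule poly_mapping_sum_single)+
  have "axis i (sum P A * sum R B) = axis i (sum P A) * axis i (sum R B)" for A B
    by (simp add: sum_product axis_sum P_def R_def single)
  then show ?thesis using p q by metis
qed

lemma axis_Const: "axis i (Const c) = [:c:]"
  by (simp add: Const_def axis_single monom_0)

lemma axis_1: "axis i 1 = 1"
  using axis_Const[of i 1] by (simp add: Const_1 one_pCons)

lemma axis_X: "axis i (X l) = (if l = i then monom 1 1 else 0)"
  by (simp add: X_def axis_single)

lemma axis_power: "axis i (p ^ n) = axis i p ^ n"
  by (induction n) (simp_all add: axis_1 axis_mult)

text \<open>
  A monomial takes the value 1 at \<open>(1, 0, \<dots>, 0)\<close> if it is a power of \<open>x\<^sub>1\<close>, and 0 otherwise.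
\<close>

lemma eval_e1: "eval p e1 = poly (axis 1 p) 1"
proof -
  have "axis 1 p = (\<Sum>m\<in>Poly_Mapping.keys p. axis 1 (Poly_Mapping.single m (Poly_Mapping.lookup p m)))"
    by (subst poly_mapping_sum_single[of p]) (rule axis_sum)
  then have "poly (axis 1 p) 1 = (\<Sum>m\<in>Poly_Mapping.keys p. if Poly_Mapping.keys m \<subseteq> {1} then Poly_Mapping.lookup p m else 0)"
    by (simp add: poly_sum axis_single poly_monom if_distrib[of "\<lambda>q. poly q 1"] cong: if_cong)
  moreover have P: "(\<Prod>i\<in>Poly_Mapping.keys m. e1 i ^ Poly_Mapping.lookup m i) = (if Poly_Mapping.keys m \<subseteq> {1} then 1 else 0)" for m
  proof (cases "Poly_Mapping.keys m \<subseteq> {1}")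
    case True
    then show ?thesis by (auto simp: e1_def intro!: prod.neutral)
  next
    case False
    then obtain l where "l \<in> Poly_Mapping.keys m" "l \<noteq> 1" by auto
    then have "e1 l ^ Poly_Mapping.lookup m l = 0" by (simp add: e1_def in_keys_iff)
    with \<open>l \<in> _\<close> False show ?thesis by (auto intro!: prod_zero)
  qed
  ultimately show ?thesis unfolding eval_def P by (simp add: if_distrib cong: if_cong)
qed

lemma lookup_times_single:
  fixes p :: mpol
  shows "Poly_Mapping.lookup (Poly_Mapping.single l c * p) (l + m) = c * Poly_Mapping.lookup p m"
proof -
  have "Poly_Mapping.lookup (Poly_Mapping.single l c * sum P A) (l + m) = c * Poly_Mapping.lookup (sum P A) m"
    if P: "P = (\<lambda>m. Poly_Mapping.single m (Poly_Mapping.lookup p m))" for A P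
    by (simp add: P sum_distrib_left mult_single lookup_sum lookup_single when_def if_distrib cong: if_cong)
  then show ?thesis using poly_mapping_sum_single[of p] by metis
qed

lemma cof_X1: "cof (X 1 * p) (Suc a) b = cof p a b"
  unfolding cof_def X_def
  using lookup_times_single[of "Poly_Mapping.single 1 1" 1 p "Poly_Mapping.single 1 a + Poly_Mapping.single 2 b"]
  by (simp add: add.assoc[symmetric] single_add[symmetric])

lemma cof_X2: "cof (X 2 * p) a (Suc b) = cof p a b"
  unfolding cof_def X_def
  using lookup_times_single[of "Poly_Mapping.single 2 1" 1 p "Poly_Mapping.single 1 a + Poly_Mapping.single 2 b"]
  by (simp add: add.left_commute single_add[symmetric])

lemma cof_axis_1: "cof p a 0 = poly.coeff (axis 1 p) a"
  and cof_axis_2: "cof p 0 b = poly.coeff (axis 2 p) b"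
  by (simp_all add: cof_def coeff_axis)

definition series_axis :: "nat \<Rightarrow> gser \<Rightarrow> real poly poly fps" where
  "series_axis i F = Abs_fps (\<lambda>n. map_poly (axis i) (fps_nth F n))"

lemma coeff_series_axis: "poly.coeff (fps_nth (series_axis i F) n) j = axis i (poly.coeff (fps_nth F n) j)"
  by (simp add: series_axis_def coeff_map_poly axis_0)

lemma series_eqI: "(\<And>n j. poly.coeff (fps_nth F n) j = poly.coeff (fps_nth G n) j) \<Longrightarrow> F = G"
  by (intro fps_ext poly_eqI)

lemma series_axis_add: "series_axis i (F + G) = series_axis i F + series_axis i G"
  and series_axis_diff: "series_axis i (F - G) = series_axis i F - series_axis i G"
  by (auto intro!: series_eqI simp: coeff_series_axis axis_add axis_diff)

lemma series_axis_mult: "series_axis i (F * G) = series_axis i F * series_axis i G"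
  by (auto intro!: series_eqI simp: coeff_series_axis fps_mult_nth coeff_sum coeff_mult axis_sum axis_mult)

lemma series_axis_1: "series_axis i 1 = 1"
  by (auto intro!: series_eqI simp: coeff_series_axis axis_0 axis_1 coeff_1)

lemma series_axis_prod: "series_axis i (prod f A) = (\<Prod>x\<in>A. series_axis i (f x))"
  by (induction A rule: infinite_finite_induct) (auto simp: series_axis_mult series_axis_1)

lemma series_axis_T: "series_axis i T = fps_X"
  by (auto intro!: series_eqI simp: coeff_series_axis T_def axis_0 axis_1 coeff_1)

lemma series_axis_S: "series_axis i S = fps_const [:0, 1:]"
  by (auto intro!: series_eqI simp: coeff_series_axis S_def axis_0 axis_1 coeff_pCons split: nat.splits)

lemma series_axis_emb: "series_axis i (emb p) = fps_const [:axis i p:]"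
  by (auto intro!: series_eqI simp: coeff_series_axis emb_def axis_0 coeff_pCons split: nat.splits)

lemma coeff_series_axis_rpow_Q: "poly.coeff (fps_nth (series_axis i (rpow (Q l) a)) n) j =
   (if l = i then monom (gegenbauer_coeff a n j) (2 * n) else if n = 0 \<and> j = 0 then 1 else 0)"
  by (auto simp: coeff_series_axis coeff_rpow_Q axis_mult axis_Const axis_power axis_X monom_power
        smult_monom gegenbauer_coeff_def power_0_left binomial_eq_0 one_pCons[symmetric])

lemma series_axis_rpow_Q_other: "l \<noteq> i \<Longrightarrow> series_axis i (rpow (Q l) a) = 1"
  by (auto intro!: series_eqI simp: coeff_series_axis_rpow_Q coeff_1)

text \<open>
  On axis \<open>i\<close> the exponent \<open>-1\<close> of one of the two separate factors and the exponent \<open>-k\<close> in the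
  product add up.
\<close>

lemma series_axis_denominator:
  assumes "i \<in> {1, 2}" "N \<ge> 2"
  shows "series_axis i (rpow (Q 1) (-1) * rpow (Q 2) (-1) * (\<Prod>l=1..N. rpow (Q l) (- k)))
     = series_axis i (rpow (Q i) (-(k+1)))"
proof -
  have "series_axis i (\<Prod>l=1..N. rpow (Q l) (- k)) = series_axis i (rpow (Q i) (- k)) * (\<Prod>l\<in>{1..N}-{i}. series_axis i (rpow (Q l) (- k)))"
    unfolding series_axis_prod using assms by (intro prod.remove) auto
  also have "(\<Prod>l\<in>{1..N}-{i}. series_axis i (rpow (Q l) (- k))) = 1"
    by (intro prod.neutral) (auto simp: series_axis_rpow_Q_other)
  finally have P: "series_axis i (\<Prod>l=1..N. rpow (Q l) (- k)) = series_axis i (rpow (Q i) (- k))" by simp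
  have "-(k+1) = -1 + (-k)" by simp
  then have "series_axis i (rpow (Q i) (-(k+1))) = series_axis i (rpow (Q i) (-1)) * series_axis i (rpow (Q i) (-k))"
    by (simp only: rpow_add[OF Q_nth_0] series_axis_mult)
  then show ?thesis using assms(1) unfolding series_axis_mult P
    by (auto simp: series_axis_rpow_Q_other)
qed

lemma coeff_series_axis_numerator:
  fixes i :: nat and \<alpha> \<beta> k :: real
  defines "g \<equiv> gegenbauer_coeff (-(k+1))"
  defines "W \<equiv> series_axis i (rpow (Q i) (-(k+1)))"
  shows "poly.coeff (fps_nth ((1 + fps_X * fps_const [:monom \<alpha> 2, monom \<beta> 2:]) * W) n) j =
    monom (g n j + (if n = 0 then 0 else \<alpha> * g (n-1) j + (if j = 0 then 0 else \<beta> * g (n-1) (j-1)))) (2 * n)"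
proof -
  have c: "poly.coeff (fps_nth W n) j = monom (g n j) (2 * n)" for n j
    by (simp add: W_def g_def coeff_series_axis_rpow_Q)
  have "(1 + fps_X * fps_const [:monom \<alpha> 2, monom \<beta> 2:]) * W = W + fps_X * (fps_const [:monom \<alpha> 2, monom \<beta> 2:] * W)"
    by (simp add: algebra_simps)
  then show ?thesis
    by (cases n; cases j) (simp_all add: c coeff_pCons mult_monom add_monom add.assoc)
qed

section \<open>The generating functions on the axes\<close>

text \<open>
  The coefficient of \<open>s\<^sup>j t\<^sup>n\<close> in \<open>(1 + \<alpha>t + \<beta>st) (1 - 2st + t\<^sup>2)\<^sup>-\<^sup>k\<^sup>-\<^sup>1\<close>.
\<close>

definition axis_coeff :: "real \<Rightarrow> real \<Rightarrow> real \<Rightarrow> nat \<Rightarrow> nat \<Rightarrow> real" where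
  "axis_coeff k \<alpha> \<beta> n j = gegenbauer_coeff (-(k+1)) n j + (if n = 0 then 0 else
      \<alpha> * gegenbauer_coeff (-(k+1)) (n-1) j + (if j = 0 then 0 else \<beta> * gegenbauer_coeff (-(k+1)) (n-1) (j-1)))"

lemma series_axis_F:
  assumes "N \<ge> 2" and i: "i \<in> {1, 2}"
  shows "series_axis i (F0 N k) = (1 - fps_X * fps_const [:0, monom 1 2:]) * series_axis i (rpow (Q i) (-(k+1)))"
    and "series_axis i (F1 N k) = fps_X * fps_const [:monom (if i = 1 then 1 else -1) 2:] * series_axis i (rpow (Q i) (-(k+1)))"
proof -
  have a: "axis i (X 1 ^ 2 + X 2 ^ 2) = monom 1 2" "axis i (X 1 ^ 2 * X 2 ^ 2) = 0"
    "axis i (X 1 ^ 2 - X 2 ^ 2) = monom (if i = 1 then 1 else -1) 2"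
    using i by (auto simp: axis_add axis_diff axis_mult axis_power axis_X monom_power minus_monom)
  have F: "F0 N k = (1 - S * T * emb (X 1 ^ 2 + X 2 ^ 2) + T ^ 2 * emb (X 1 ^ 2 * X 2 ^ 2))
      * (rpow (Q 1) (-1) * rpow (Q 2) (-1) * (\<Prod>l=1..N. rpow (Q l) (- k)))"
    "F1 N k = T * emb (X 1 ^ 2 - X 2 ^ 2)
      * (rpow (Q 1) (-1) * rpow (Q 2) (-1) * (\<Prod>l=1..N. rpow (Q l) (- k)))"
    by (simp_all only: F0_def F1_def mult.assoc)
  have ST: "fps_const [:0, 1:] * fps_X * fps_const [:monom 1 2:]
      = fps_X * fps_const [:0, monom 1 2 :: real poly:]"
    unfolding mult.assoc mult.left_commute[of _ fps_X] by simp
  show "series_axis i (F0 N k) = (1 - fps_X * fps_const [:0, monom 1 2:]) * series_axis i (rpow (Q i) (-(k+1)))"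
    unfolding F series_axis_mult[of i "_ + _"] series_axis_denominator[OF i assms(1)]
    unfolding series_axis_add series_axis_diff series_axis_1 series_axis_mult series_axis_S series_axis_T series_axis_emb a ST by simp
  show "series_axis i (F1 N k) = fps_X * fps_const [:monom (if i = 1 then 1 else -1) 2:] * series_axis i (rpow (Q i) (-(k+1)))"
    unfolding F series_axis_mult[of i "_ * emb _"] series_axis_denominator[OF i assms(1)]
    by (simp only: series_axis_mult series_axis_T series_axis_emb a)
qed

lemma axis_phi:
  assumes "N \<ge> 2" and i: "i \<in> {1, 2}"
  shows "axis i (phi N k n j) = monom (axis_coeff k (if i = 1 then 1 else -1) (-1) n j) (2 * n)"
proof -
  have "series_axis i (F0 N k + F1 N k) = (1 + fps_X * fps_const [:monom (if i = 1 then 1 else -1) 2, monom (-1) 2:])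
      * series_axis i (rpow (Q i) (-(k+1)))"
  proof -
    have ring: "(1 - x * y) * w + x * z * w = (1 + x * (z - y)) * w" for x y z w :: "real poly poly fps"
      by (simp add: algebra_simps)
    have "fps_const [:monom \<alpha> 2 :: real poly:] - fps_const [:0, monom 1 2:] =
        fps_const [:monom \<alpha> 2, monom (-1) 2:]" for \<alpha>
      by (simp add: minus_monom)
    then show ?thesis unfolding series_axis_add series_axis_F[OF assms] ring by (simp only:)
  qed
  then show ?thesis
    by (simp only: phi_def coeff_series_axis[symmetric] coeff_series_axis_numerator axis_coeff_def)
qed

definition psi_cofactor where "psi_cofactor N k n j = poly.coeff (fps_nth (F0 N k + (S - 1) * F1 N k) n) j"

lemma psi_eq: "psi N k n j = X 1 * psi_cofactor N k n j"
proof -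
  have "emb (X 1) * (F0 N k + S * F1 N k) - emb (X 1) * F1 N k = fps_const [:X 1:] * (F0 N k + (S - 1) * F1 N k)"
    by (simp add: emb_def algebra_simps)
  then show ?thesis by (simp add: psi_def psi_cofactor_def)
qed

lemma axis_psi_cofactor:
  assumes "N \<ge> 2" and i: "i \<in> {1, 2}"
  shows "axis i (psi_cofactor N k n j) = monom (axis_coeff k (if i = 1 then -1 else 1) (if i = 1 then 0 else -2) n j) (2 * n)"
proof -
  have "series_axis i (F0 N k + (S - 1) * F1 N k) = (1 + fps_X *
      fps_const [:monom (if i = 1 then -1 else 1) 2, monom (if i = 1 then 0 else -2) 2:])
      * series_axis i (rpow (Q i) (-(k+1)))"
  proof -
    have ring: "(1 - x * y) * w + (s - 1) * (x * z * w) = (1 + x * ((s - 1) * z - y)) * w"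
      for s x y z w :: "real poly poly fps"
      by (simp add: algebra_simps)
    have "(fps_const [:0, 1:] - 1) * fps_const [:monom (if i = 1 then 1 else -1) 2 :: real poly:]
        - fps_const [:0, monom 1 2:] =
      fps_const [:monom (if i = 1 then -1 else 1) 2, monom (if i = 1 then 0 else -2) 2:]"
      by (simp add: left_diff_distrib minus_monom add_monom diff_monom)
    then show ?thesis
      unfolding series_axis_add series_axis_mult series_axis_diff series_axis_S series_axis_1 series_axis_F[OF assms] ring by (simp only:)
  qed
  then show ?thesis
    by (simp only: psi_cofactor_def coeff_series_axis[symmetric] coeff_series_axis_numerator axis_coeff_def)
qed

lemma cof_add: "cof (p + q) a b = cof p a b + cof q a b"
  by (simp add: cof_def lookup_add)

lemma cof_sum: "cof (sum f A) a b = (\<Sum>x\<in>A. cof (f x) a b)"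
  by (simp add: cof_def lookup_sum)

lemma cof_Const_mult: "cof (Const c * p) a b = c * cof p a b"
  using lookup_times_single[of 0 c p] by (simp add: cof_def Const_def)

lemma eval_e1_sum: "eval (\<Sum>j\<in>A. Const (w j) * p j) e1 = (\<Sum>j\<in>A. w j * eval (p j) e1)"
  by (simp add: eval_e1 axis_sum axis_mult axis_Const poly_sum)

lemma cof_phi:
  assumes "N \<ge> 2"
  shows "cof (phi N k n j) (2 * n) 0 = axis_coeff k 1 (-1) n j"
    and "cof (phi N k n j) 0 (2 * n) = axis_coeff k (-1) (-1) n j"
    and "eval (phi N k n j) e1 = axis_coeff k 1 (-1) n j"
  using axis_phi[OF assms, of 1] axis_phi[OF assms, of 2]
  by (simp_all add: cof_axis_1 cof_axis_2 eval_e1 poly_monom)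

lemma cof_psi:
  assumes "N \<ge> 2"
  shows "cof (psi N k n j) (Suc (2 * n)) 0 = axis_coeff k (-1) 0 n j"
    and "cof (psi N k n j) (Suc 0) (2 * n) = axis_coeff k 1 (-2) n j"
  unfolding psi_eq cof_X1 unfolding cof_axis_1 cof_axis_2
  using axis_psi_cofactor[OF assms, of 1] axis_psi_cofactor[OF assms, of 2] by simp_all

text \<open>
  This trades the second axis for the first: \<open>1 + t - 2st = 2(1 - st) - (1 - t)\<close>.
\<close>

lemma axis_coeff_psi_sum: "axis_coeff k 1 (-2) n j = 2 * axis_coeff k 0 (-1) n j - axis_coeff k (-1) 0 n j"
  by (simp add: axis_coeff_def)

section \<open>Gegenbauer coefficients in terms of Pochhammer symbols\<close>

text \<open>
  The value at \<open>s = 0\<close> of the Gegenbauer polynomial of degree \<open>2n\<close> and order \<open>l\<close>. It is independent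
  of the summation index and factors out of every sum.
\<close>

definition lead_factor :: "real \<Rightarrow> nat \<Rightarrow> real" where
  "lead_factor l n = (-1)^n * pochhammer l n / fact n"

lemma lead_factor_Suc: "lead_factor l (Suc n) = - lead_factor l n * (l + real n) / (real n + 1)"
  unfolding lead_factor_def by (simp add: pochhammer_Suc divide_inverse ac_simps)

lemma fact_double_half: "(fact (2 * j) :: real) = 4 ^ j * fact j * pochhammer (1/2) j"
  unfolding fact_double power_mult by simp

text \<open>
  The factor \<open>(1/2)\<^sub>j\<close> comes from \<open>(2j)! = 4\<^sup>j j! (1/2)\<^sub>j\<close>.
\<close>

lemma gegenbauer_coeff_even:
  "pochhammer (1/2) j * gegenbauer_coeff (-l) (2*n) (2*j) = lead_factor l n * ((-1)^j * of_nat (n choose j) * pochhammer (l + real n) j)"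
proof (cases "j \<le> n")
  case True
  have h: "pochhammer (1/2::real) j > 0" by (rule pochhammer_pos) simp
  have b: "real (n + j choose (2*j)) = fact (n + j) / (fact (2*j) * fact (n - j))"
    using True by (subst binomial_fact) auto
  have c: "real (n choose j) = fact n / (fact j * fact (n - j))"
    using True by (rule binomial_fact)
  have g: "gegenbauer_coeff (-l) (2*n) (2*j) = (-l gchoose (n+j)) * real (n + j choose (2*j)) * 4^j"
    by (simp add: gegenbauer_coeff_def power_mult)
  have s: "(-1::real)^(n+j) = (-1)^n * (-1)^j" by (rule power_add)
  show ?thesis unfolding g b c gbinomial_pochhammer lead_factor_def fact_double_half s
    using h by (simp add: pochhammer_product'[of l n j])
qed (simp add: gegenbauer_coeff_def binomial_eq_0)

lemma gegenbauer_coeff_odd: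
  "pochhammer (1/2) (Suc j) * gegenbauer_coeff (-l) (Suc (2*n)) (Suc (2*j)) =
     lead_factor l n * ((-1)^j * of_nat (n choose j) * pochhammer (l + real n) (Suc j))"
proof (cases "j \<le> n")
  case True
  have h: "pochhammer (1/2::real) j > 0" by (rule pochhammer_pos) simp
  have b: "real (Suc (n + j) choose (Suc (2*j))) = fact (Suc (n + j)) / (fact (Suc (2*j)) * fact (n - j))"
    using True by (subst binomial_fact) auto
  have c: "real (n choose j) = fact n / (fact j * fact (n - j))"
    using True by (rule binomial_fact)
  have e: "(Suc (2*n) + Suc (2*j)) div 2 = Suc (n + j)" by simp
  have g: "gegenbauer_coeff (-l) (Suc (2*n)) (Suc (2*j)) = (-l gchoose (Suc (n+j))) * real (Suc (n + j) choose Suc (2*j)) * (-2*4^j)"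
    unfolding gegenbauer_coeff_def e by (simp add: power_mult)
  have s: "(-1::real)^(Suc (n+j)) = - ((-1)^n * (-1)^j)" by (simp add: power_add)
  have p: "pochhammer l (Suc (n + j)) = pochhammer l n * pochhammer (l + real n) (Suc j)"
    using pochhammer_product'[of l n "Suc j"] by simp
  have f: "(fact (Suc (2*j)) :: real) = (2 * real j + 1) * (4^j * fact j * pochhammer (1/2) j)"
    unfolding fact_double_half[symmetric] by (simp add: algebra_simps)
  have q: "pochhammer (1/2::real) (Suc j) = pochhammer (1/2) j * (2 * real j + 1) / 2"
    by (simp add: pochhammer_Suc field_simps)
  have "2 * real j + 1 > 0" by simp
  then show ?thesis unfolding g b c gbinomial_pochhammer lead_factor_def f s p minus_minus q
    using h by (simp add: divide_simps del: fact_Suc)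
qed (simp add: gegenbauer_coeff_def binomial_eq_0)

lemma of_nat_Suc_choose_Suc: "real (Suc n choose Suc j) = (real n + 1) / (real j + 1) * real (n choose j)"
proof -
  have "real (Suc j) * real (Suc n choose Suc j) = real (Suc n) * real (n choose j)"
    unfolding of_nat_mult[symmetric] Suc_times_binomial_eq by (simp add: mult.commute)
  then show ?thesis by (simp add: field_simps)
qed

text \<open>
  The two Gegenbauer coefficients differ by the factor \<open>j / (k + n + j)\<close>, so subtracting replaces
  \<open>(k + 1 + n)\<^sub>j\<close> by \<open>(k + n)\<^sub>j\<close>. Parity removes the term with \<open>\<alpha>\<close>.
\<close>

lemma gegenbauer_coeff_even_diff:
  "pochhammer (1/2) j * axis_coeff k \<alpha> (-1) (2*n) (2*j) =
    lead_factor (k+1) n * ((-1)^j * of_nat (n choose j) * pochhammer (k + real n) j)"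
proof (cases "n = 0 \<or> j = 0")
  case True
  then show ?thesis
    using gegenbauer_coeff_even[of j "k+1" n] by (auto simp: axis_coeff_def gegenbauer_coeff_def)
next
  case False
  then obtain m i where n: "n = Suc m" and j: "j = Suc i" by (metis not0_implies_Suc)
  let ?l = "k + 1" and ?u = "lead_factor (k+1) m * ((-1)^i * real (m choose i))"
  have "odd (2 * n - 1 + 2 * j)" by (simp add: n)
  then have "axis_coeff k \<alpha> (-1) (2*n) (2*j) = gegenbauer_coeff (-?l) (2*n) (2*j) - gegenbauer_coeff (-?l) (Suc (2*m)) (Suc (2*i))"
    by (simp add: axis_coeff_def n j) (simp add: gegenbauer_coeff_def)
  then have "pochhammer (1/2) j * axis_coeff k \<alpha> (-1) (2*n) (2*j) =
      lead_factor ?l n * ((-1)^j * real (n choose j) * pochhammer (?l + real n) j)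
      - ?u * pochhammer (?l + real m) (Suc i)"
    using gegenbauer_coeff_even[of j ?l n] gegenbauer_coeff_odd[of i ?l m] by (simp add: right_diff_distrib j mult.assoc)
  also have A: "lead_factor ?l n * ((-1)^j * real (n choose j) * x) = ?u * ((?l + real m) / (real i + 1) * x)" for x
  proof -
    have "- g * L / M * (- 1 * s * (M / I * C) * y) = g * (s * C) * (L / I * y)"
      if "M \<noteq> 0" for g L M s I C y :: real
      using that by simp
    moreover have "real m + 1 \<noteq> 0" by linarith
    ultimately show ?thesis unfolding n j lead_factor_Suc of_nat_Suc_choose_Suc power_Suc by blast
  qed
  also have "(?l + real m) / (real i + 1) * pochhammer (?l + real n) j =
     (?l + real m) * pochhammer (?l + real m + 1) j / (real i + 1)"
    by (simp add: n algebra_simps)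
  also have "\<dots> = pochhammer (?l + real m) j * (?l + real m + real j) / (real i + 1)"
    by (simp only: pochhammer_shift)
  finally have "pochhammer (1/2) j * axis_coeff k \<alpha> (-1) (2*n) (2*j) =
      ?u * (pochhammer (?l + real m) j * (?l + real m + real j) / (real i + 1) - pochhammer (?l + real m) j)"
    by (simp add: right_diff_distrib j)
  also have "pochhammer (?l + real m) j * (?l + real m + real j) / (real i + 1) - pochhammer (?l + real m) j
     = (?l + real m) / (real i + 1) * pochhammer (?l + real m) j"
    by (simp add: j field_simps)
  also have "?l + real m = k + real n" by (simp add: n)
  finally show ?thesis unfolding A by (simp add: n algebra_simps)
qed

text \<open>
  Up to a common product the two coefficients are \<open>k + 1 + n + j\<close> and \<open>1/2 + j\<close>. Their difference is
  constant in \<open>j\<close>, so the difference of the coefficients is again a single product.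
\<close>

lemma gegenbauer_coeff_odd_diff:
  "pochhammer (1/2) (Suc j) * axis_coeff k 0 (-1) (Suc (2*n)) (Suc (2*j)) =
    (k + real n + 1/2) * (lead_factor (k+1) n * ((-1)^j * of_nat (n choose j) * pochhammer (k + 1 + real n) j))"
proof -
  let ?v = "lead_factor (k+1) n * ((-1)^j * of_nat (n choose j))"
  have "axis_coeff k 0 (-1) (Suc (2*n)) (Suc (2*j)) = gegenbauer_coeff (-(k+1)) (Suc (2*n)) (Suc (2*j)) - gegenbauer_coeff (-(k+1)) (2*n) (2*j)"
    by (simp add: axis_coeff_def)
  then have "pochhammer (1/2) (Suc j) * axis_coeff k 0 (-1) (Suc (2*n)) (Suc (2*j)) =
     pochhammer (1/2) (Suc j) * gegenbauer_coeff (-(k+1)) (Suc (2*n)) (Suc (2*j))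
      - (1/2 + real j) * (pochhammer (1/2) j * gegenbauer_coeff (-(k+1)) (2*n) (2*j))"
    by (simp only: right_diff_distrib pochhammer_rec'[of "1/2"] mult.assoc)
  also have "\<dots> = ?v * pochhammer (k + 1 + real n) (Suc j) - (1/2 + real j) * (?v * pochhammer (k + 1 + real n) j)"
    unfolding gegenbauer_coeff_odd gegenbauer_coeff_even by (simp only: mult.assoc)
  also have "\<dots> = (k + real n + 1/2) * (?v * pochhammer (k + 1 + real n) j)"
    unfolding pochhammer_Suc by (simp add: algebra_simps)
  finally show ?thesis by (simp only: mult.assoc)
qed

section \<open>The sums over Gegenbauer coefficients\<close>

lemma pochhammer_pos_ne: "x > 0 \<Longrightarrow> pochhammer x n \<noteq> 0" for x :: real
  using pochhammer_pos[of x n] by simp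

text \<open>
  By \<open>gegenbauer_coeff_even_diff\<close> the upper parameter is \<open>a = k + n\<close>, and the condition on \<open>b\<close> is
  precisely the balance condition.
\<close>

lemma phi_even_sum:
  assumes "c > 0" "d > 0" and b: "b = c + d - k - 1"
  shows "(\<Sum>j=0..n. pochhammer b j * pochhammer (1/2) j / (pochhammer c j * pochhammer d j) * axis_coeff k \<alpha> (-1) (2*n) (2*j))
    = lead_factor (k+1) n * (pochhammer (c - k - real n) n * pochhammer (d - k - real n) n / (pochhammer c n * pochhammer d n))"
proof -
  have "pochhammer b j * pochhammer (1/2) j / (pochhammer c j * pochhammer d j) * axis_coeff k \<alpha> (-1) (2*n) (2*j)
    = lead_factor (k+1) n * hyp_term n (k + real n) b c d j" for j
  proof -
    have "pochhammer b j * pochhammer (1/2) j / (pochhammer c j * pochhammer d j) * axis_coeff k \<alpha> (-1) (2*n) (2*j)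
      = pochhammer b j / (pochhammer c j * pochhammer d j) * (pochhammer (1/2) j * axis_coeff k \<alpha> (-1) (2*n) (2*j))"
      by simp
    then show ?thesis unfolding gegenbauer_coeff_even_diff hyp_term_def by simp
  qed
  then have "(\<Sum>j=0..n. pochhammer b j * pochhammer (1/2) j / (pochhammer c j * pochhammer d j) * axis_coeff k \<alpha> (-1) (2*n) (2*j))
    = lead_factor (k+1) n * (\<Sum>j\<le>n. hyp_term n (k + real n) b c d j)"
    by (simp add: sum_distrib_left atLeast0AtMost)
  moreover have "b = c + d - (k + real n) + real n - 1" by (simp add: b)
  ultimately show ?thesis
    using saalschuetz[of c n d "k + real n"] assms(1,2) by (simp add: pochhammer_pos_ne diff_diff_eq)
qed

text \<open>
  For odd \<open>t\<close>-degree and even \<open>s\<close>-degree only the coefficient multiplied by \<open>\<alpha>\<close> has the right parity,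
  so the upper parameter is \<open>a = k + 1 + n\<close>.
\<close>

lemma phi_odd_sum:
  assumes "c > 0" "d > 0" and b: "b = c + d - k - 2"
  shows "(\<Sum>j=0..n. pochhammer b j * pochhammer (1/2) j / (pochhammer c j * pochhammer d j) * axis_coeff k \<alpha> \<beta> (2*n+1) (2*j))
    = \<alpha> * lead_factor (k+1) n * (pochhammer (c - k - 1 - real n) n * pochhammer (d - k - 1 - real n) n / (pochhammer c n * pochhammer d n))"
proof -
  have n: "axis_coeff k \<alpha> \<beta> (2*n+1) (2*j) = \<alpha> * gegenbauer_coeff (-(k+1)) (2*n) (2*j)" for j
    by (cases j) (simp_all add: axis_coeff_def gegenbauer_coeff_def)
  have "pochhammer b j * pochhammer (1/2) j / (pochhammer c j * pochhammer d j) * axis_coeff k \<alpha> \<beta> (2*n+1) (2*j)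
    = \<alpha> * lead_factor (k+1) n * hyp_term n (k + 1 + real n) b c d j" for j
  proof -
    have "pochhammer b j * pochhammer (1/2) j / (pochhammer c j * pochhammer d j) * axis_coeff k \<alpha> \<beta> (2*n+1) (2*j)
      = \<alpha> * (pochhammer b j / (pochhammer c j * pochhammer d j)) * (pochhammer (1/2) j * gegenbauer_coeff (-(k+1)) (2*n) (2*j))"
      unfolding n by simp
    then show ?thesis unfolding gegenbauer_coeff_even hyp_term_def by simp
  qed
  then have "(\<Sum>j=0..n. pochhammer b j * pochhammer (1/2) j / (pochhammer c j * pochhammer d j) * axis_coeff k \<alpha> \<beta> (2*n+1) (2*j))
    = \<alpha> * lead_factor (k+1) n * (\<Sum>j\<le>n. hyp_term n (k + 1 + real n) b c d j)"
    by (simp add: sum_distrib_left atLeast0AtMost)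
  moreover have "b = c + d - (k + 1 + real n) + real n - 1" by (simp add: b)
  ultimately show ?thesis
    using saalschuetz[of c n d "k + 1 + real n"] assms(1,2) by (simp add: pochhammer_pos_ne diff_diff_eq)
qed

lemma sum_split_0: "sum f {0..n} = f 0 + sum f {1..n}" for f :: "nat \<Rightarrow> real"
  using sum.atLeast_Suc_atMost[of 0 n f] by simp

text \<open>
  The \<open>j\<close>-th terms of the two sums are multiples of one hypergeometric term with \<open>a = k + n\<close> and
  \<open>B = b - 1\<close>. Their sum carries the factor \<open>(a + j)(B + j) - j(c + j - 1)\<close>, which is only linear in \<open>j\<close>
  since the squares cancel; \<open>saalschuetz_next\<close> applies.
\<close>

lemma psi_even_sum:
  assumes "c > 1" "d > 0" "k > 0" "c + d - k - 2 > 0" and b: "b = c + d - k - 1"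
  shows "(\<Sum>j=0..n. pochhammer b j * pochhammer (1/2) j / (pochhammer c j * pochhammer d j) * axis_coeff k (-1) 0 (2*n) (2*j))
      + (\<Sum>j=1..n. pochhammer b (j-1) * pochhammer (1/2) j / (pochhammer c (j-1) * pochhammer d j) * axis_coeff k (-1) 0 (2*n) (2*j-1))
    = lead_factor (k+1) n * (pochhammer (c - k - real n - 1) n * pochhammer (d - k - real n) n / (pochhammer c n * pochhammer d n))"
    (is "?L = _")
proof (cases n)
  case 0
  then show ?thesis by (simp add: axis_coeff_def gegenbauer_coeff_def lead_factor_def)
next
  case (Suc m)
  define a where "a = k + real n"
  define B where "B = b - 1"
  define q where "q = (a + B - c + 1) / (a * B)"
  have pos: "a > 0" "B > 0" "c > 0" using assms by (auto simp: a_def B_def)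
  have a: "a = k + 1 + real m" by (simp add: a_def Suc)
  have summand: "pochhammer b j * pochhammer (1/2) j / (pochhammer c j * pochhammer d j) * axis_coeff k (-1) 0 (2*n) (2*j)
      + pochhammer b (j-1) * pochhammer (1/2) j / (pochhammer c (j-1) * pochhammer d j) * axis_coeff k (-1) 0 (2*n) (2*j-1)
    = lead_factor (k+1) n * (hyp_term n a B c d j * (1 + q * real j))" if j1: "j \<ge> 1" for j
  proof -
    obtain i where j: "j = Suc i" using j1 by (cases j) auto
    define P where "P = lead_factor (k+1) n * ((-1)^j * real (n choose j) * pochhammer a j)"
    define R where "R = pochhammer B j / (pochhammer c j * pochhammer d j)"
    have ne: "pochhammer c i \<noteq> 0" "pochhammer d j \<noteq> 0" "c + real i \<noteq> 0"
      using pos assms by (auto simp: pochhammer_pos_ne add_pos_nonneg dest: less_imp_neq)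
    have g1: "pochhammer (1/2) j * axis_coeff k (-1) 0 (2*n) (2*j) = P * (a + real j) / a"
    proof -
      have "axis_coeff k (-1) 0 (2*n) (2*j) = gegenbauer_coeff (-(k+1)) (2*n) (2*j)"
        by (simp add: axis_coeff_def) (simp add: gegenbauer_coeff_def Suc)
      then have "pochhammer (1/2) j * axis_coeff k (-1) 0 (2*n) (2*j) = lead_factor (k+1) n * ((-1)^j * real (n choose j) * pochhammer (a + 1) j)"
        by (simp only: gegenbauer_coeff_even a_def) (simp add: add_ac)
      also have "pochhammer (a + 1) j = pochhammer a j * (a + real j) / a"
        using pochhammer_shift[of a j] pos by (simp add: field_simps)
      finally show ?thesis by (simp add: P_def)
    qed
    have g2: "pochhammer (1/2) j * axis_coeff k (-1) 0 (2*n) (2*j-1) = - P * real j / a"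
    proof -
      have "axis_coeff k (-1) 0 (2*n) (2*j-1) = - gegenbauer_coeff (-(k+1)) (Suc (2*m)) (Suc (2*i))"
        by (simp add: axis_coeff_def Suc j) (simp add: gegenbauer_coeff_def)
      then have "pochhammer (1/2) j * axis_coeff k (-1) 0 (2*n) (2*j-1) =
          - (lead_factor (k+1) m * ((-1)^i * real (m choose i) * pochhammer a j))"
        unfolding a using gegenbauer_coeff_odd[of i "k+1" m] by (simp add: j)
      moreover have "P = - lead_factor (k+1) m * a / (real m + 1) * (- 1 * (-1)^i * ((real m + 1) / real j * real (m choose i)) * pochhammer a j)"
        unfolding P_def unfolding Suc j lead_factor_Suc of_nat_Suc_choose_Suc power_Suc by (simp add: a add.commute)
      moreover have "real m + 1 \<noteq> 0" "real j \<noteq> 0" using j by simp_all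
      ultimately show ?thesis using pos by simp
    qed
    have r1: "pochhammer b j / (pochhammer c j * pochhammer d j) = R * (B + real j) / B"
    proof -
      have "pochhammer b j = pochhammer B j * (B + real j) / B"
        using pochhammer_shift[of B j] pos by (simp add: B_def field_simps)
      then show ?thesis by (simp add: R_def)
    qed
    have r2: "pochhammer b (j-1) / (pochhammer c (j-1) * pochhammer d j) = R * (c + real i) / B"
    proof -
      have "pochhammer B j = B * pochhammer b i" by (simp add: j pochhammer_rec B_def)
      then show ?thesis using pos ne by (simp add: R_def j pochhammer_Suc[of c])
    qed
    have "pochhammer b j * pochhammer (1/2) j / (pochhammer c j * pochhammer d j) * axis_coeff k (-1) 0 (2*n) (2*j)
      + pochhammer b (j-1) * pochhammer (1/2) j / (pochhammer c (j-1) * pochhammer d j) * axis_coeff k (-1) 0 (2*n) (2*j-1)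
      = (pochhammer b j / (pochhammer c j * pochhammer d j)) * (pochhammer (1/2) j * axis_coeff k (-1) 0 (2*n) (2*j))
      + (pochhammer b (j-1) / (pochhammer c (j-1) * pochhammer d j)) * (pochhammer (1/2) j * axis_coeff k (-1) 0 (2*n) (2*j-1))"
      by simp
    also have "\<dots> = P * R * (((a + real j) * (B + real j) - real j * (c + real i)) / (a * B))"
      unfolding g1 g2 r1 r2 using pos by (simp add: field_simps)
    also have "((a + real j) * (B + real j) - real j * (c + real i)) = a * B + (a + B - c + 1) * real j"
      by (simp add: j algebra_simps)
    also have "\<dots> / (a * B) = 1 + q * real j"
      unfolding q_def add_divide_distrib[of "a * B"] using pos by simp
    finally show ?thesis by (simp add: P_def R_def hyp_term_def)
  qed
  have zero: "pochhammer b 0 * pochhammer (1/2) 0 / (pochhammer c 0 * pochhammer d 0) * axis_coeff k (-1) 0 (2*n) (2*0)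
    = lead_factor (k+1) n * (hyp_term n a B c d 0 * (1 + q * real 0))"
    using gegenbauer_coeff_even[of 0 "k+1" n] by (simp add: axis_coeff_def hyp_term_def) (simp add: gegenbauer_coeff_def Suc)
  have "?L = (\<Sum>j\<le>n. lead_factor (k+1) n * (hyp_term n a B c d j * (1 + q * real j)))"
    unfolding sum_split_0[of _ n] atLeast0AtMost[symmetric] zero add.assoc sum.distrib[symmetric]
    by (intro arg_cong2[of _ _ _ _ "(+)"] sum.cong refl summand) auto
  also have "\<dots> = lead_factor (k+1) n * (\<Sum>j\<le>Suc m. hyp_term (Suc m) a B c d j * (1 + q * real j))"
    by (simp only: sum_distrib_left Suc)
  also have "(\<Sum>j\<le>Suc m. hyp_term (Suc m) a B c d j * (1 + q * real j)) =
     pochhammer (c - a) m * pochhammer (d - a) m / (pochhammer c n * pochhammer d n)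
      * (1 * ((c - a + real m) * (d - a + real m) + (real m + 1) * a) - q * (real m + 1) * a * B)"
    unfolding Suc using assms
    by (intro saalschuetz_next) (auto simp: pochhammer_pos_ne B_def a)
  also have "q * (real m + 1) * a * B = (real m + 1) * (a + B - c + 1)"
    using pos by (simp add: q_def)
  also have "1 * ((c - a + real m) * (d - a + real m) + (real m + 1) * a) - (real m + 1) * (a + B - c + 1)
     = (c - a - 1) * (d - a + real m)"
    unfolding B_def b a by (simp add: algebra_simps)
  also have "pochhammer (c - a) m * pochhammer (d - a) m / (pochhammer c n * pochhammer d n) * ((c - a - 1) * (d - a + real m))
    = pochhammer (c - a - 1) n * pochhammer (d - a) n / (pochhammer c n * pochhammer d n)"
    unfolding Suc pochhammer_rec[of "c - a - 1"] pochhammer_Suc[of "d - a"] by simp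
  finally show ?thesis by (simp add: a_def diff_diff_eq)
qed

text \<open>
  As for \<open>psi_even_sum\<close>, now with \<open>a = k + 1 + n\<close> and upper index \<open>M = n + 1\<close>, so that the
  linear factor is \<open>(M - j)(B + j) + j(d + j - 1)\<close>. The first sum may be extended to \<open>j = n + 1\<close>, where its term vanishes.
\<close>

lemma psi_odd_sum:
  assumes "c > 1" "d > 0" "k > 0" "c + d - k - 2 > 0" and b: "b = c + d - k - 1"
  shows "(\<Sum>j=0..n. pochhammer b j * pochhammer (1/2) j / (pochhammer c j * pochhammer d j) * axis_coeff k (-1) 0 (2*n+1) (2*j))
      + (\<Sum>j=1..n+1. pochhammer b (j-1) * pochhammer (1/2) j / (pochhammer c j * pochhammer d (j-1)) * axis_coeff k (-1) 0 (2*n+1) (2*j-1))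
    = - lead_factor (k+1) n * (pochhammer (c - k - 1 - real n) (n+1) * pochhammer (d - k - 1 - real n) n / (pochhammer c (n+1) * pochhammer d n))"
    (is "?L = _")
proof -
  define a where "a = k + 1 + real n"
  define B where "B = b - 1"
  define M where "M = real n + 1"
  define p where "p = M / a"
  define q where "q = (M - B + d - 1) / (B * a)"
  define g where "g = lead_factor (k+1) (Suc n)"
  have pos: "a > 0" "B > 0" "c > 0" "M > 0" using assms by (auto simp: a_def B_def M_def)
  have gg: "lead_factor (k+1) n = - g * M / a" using pos by (simp add: g_def lead_factor_Suc a_def M_def)
  have summand: "pochhammer b j * pochhammer (1/2) j / (pochhammer c j * pochhammer d j) * axis_coeff k (-1) 0 (2*n+1) (2*j)
      + pochhammer b (j-1) * pochhammer (1/2) j / (pochhammer c j * pochhammer d (j-1)) * axis_coeff k (-1) 0 (2*n+1) (2*j-1)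
    = g * (hyp_term (Suc n) a B c d j * (p + q * real j))" if j1: "j \<ge> 1" for j
  proof -
    obtain i where j: "j = Suc i" using j1 by (cases j) auto
    define P where "P = g * ((-1)^j * real (Suc n choose j) * pochhammer a j)"
    define R where "R = pochhammer B j / (pochhammer c j * pochhammer d j)"
    have ne: "pochhammer d i \<noteq> 0" "pochhammer c j \<noteq> 0" "d + real i \<noteq> 0"
      using pos assms by (auto simp: pochhammer_pos_ne add_pos_nonneg dest: less_imp_neq)
    have C1: "real (n choose j) = real (Suc n choose j) * (M - real j) / M"
      using of_nat_Suc_choose_Suc[of n i] of_nat_choose_Suc[of i n, where ?'a = real] pos
      by (simp add: j M_def field_simps)
    have C2: "real (n choose i) = real (Suc n choose j) * real j / M"
      using of_nat_Suc_choose_Suc[of n i] pos unfolding j M_def[symmetric] by (simp add: add.commute)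
    have g1: "pochhammer (1/2) j * axis_coeff k (-1) 0 (2*n+1) (2*j) = P * (M - real j) / a"
    proof -
      have "axis_coeff k (-1) 0 (2*n+1) (2*j) = - gegenbauer_coeff (-(k+1)) (2*n) (2*j)"
        by (simp add: axis_coeff_def) (simp add: gegenbauer_coeff_def)
      then have "pochhammer (1/2) j * axis_coeff k (-1) 0 (2*n+1) (2*j) = - (lead_factor (k+1) n * ((-1)^j * real (n choose j) * pochhammer a j))"
        by (simp only: mult_minus_right gegenbauer_coeff_even a_def)
      then show ?thesis unfolding gg C1 P_def using pos by simp
    qed
    have g2: "pochhammer (1/2) j * axis_coeff k (-1) 0 (2*n+1) (2*j-1) = P * real j / a"
    proof -
      have "axis_coeff k (-1) 0 (2*n+1) (2*j-1) = gegenbauer_coeff (-(k+1)) (Suc (2*n)) (Suc (2*i))"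
        by (simp add: axis_coeff_def j) (simp add: gegenbauer_coeff_def)
      then have "pochhammer (1/2) j * axis_coeff k (-1) 0 (2*n+1) (2*j-1) = lead_factor (k+1) n * ((-1)^i * real (n choose i) * pochhammer a j)"
        unfolding a_def using gegenbauer_coeff_odd[of i "k+1" n] by (simp add: j)
      then show ?thesis unfolding gg C2 P_def using pos by (simp add: j)
    qed
    have r1: "pochhammer b j / (pochhammer c j * pochhammer d j) = R * (B + real j) / B"
    proof -
      have "pochhammer b j = pochhammer B j * (B + real j) / B"
        using pochhammer_shift[of B j] pos by (simp add: B_def field_simps)
      then show ?thesis by (simp add: R_def)
    qed
    have r2: "pochhammer b (j-1) / (pochhammer c j * pochhammer d (j-1)) = R * (d + real i) / B"
    proof -
      have "pochhammer B j = B * pochhammer b i" by (simp add: j pochhammer_rec B_def)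
      then show ?thesis using pos ne by (simp add: R_def j pochhammer_Suc[of d])
    qed
    have "pochhammer b j * pochhammer (1/2) j / (pochhammer c j * pochhammer d j) * axis_coeff k (-1) 0 (2*n+1) (2*j)
      + pochhammer b (j-1) * pochhammer (1/2) j / (pochhammer c j * pochhammer d (j-1)) * axis_coeff k (-1) 0 (2*n+1) (2*j-1)
      = (pochhammer b j / (pochhammer c j * pochhammer d j)) * (pochhammer (1/2) j * axis_coeff k (-1) 0 (2*n+1) (2*j))
      + (pochhammer b (j-1) / (pochhammer c j * pochhammer d (j-1))) * (pochhammer (1/2) j * axis_coeff k (-1) 0 (2*n+1) (2*j-1))"
      by simp
    also have "\<dots> = P * R * (((M - real j) * (B + real j) + real j * (d + real i)) / (B * a))"
      unfolding g1 g2 r1 r2 using pos by (simp add: field_simps)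
    also have "((M - real j) * (B + real j) + real j * (d + real i)) = M * B + (M - B + d - 1) * real j"
      by (simp add: j algebra_simps)
    also have "\<dots> / (B * a) = p + q * real j"
      unfolding p_def q_def add_divide_distrib[of "M * B"] using pos by simp
    finally show ?thesis by (simp add: P_def R_def hyp_term_def)
  qed
  have zero: "pochhammer b 0 * pochhammer (1/2) 0 / (pochhammer c 0 * pochhammer d 0) * axis_coeff k (-1) 0 (2*n+1) (2*0)
    = g * (hyp_term (Suc n) a B c d 0 * (p + q * real 0))"
  proof -
    have "axis_coeff k (-1) 0 (2*n+1) (2*0) = - lead_factor (k+1) n"
      using gegenbauer_coeff_even[of 0 "k+1" n] by (simp add: axis_coeff_def) (simp add: gegenbauer_coeff_def)
    then show ?thesis by (simp add: gg hyp_term_def p_def)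
  qed
  \<comment> \<open>The Gegenbauer coefficient in the term \<open>j = n + 1\<close> has \<open>s\<close>-degree above its \<open>t\<close>-degree.\<close>
  have last: "(\<Sum>j=0..n. pochhammer b j * pochhammer (1/2) j / (pochhammer c j * pochhammer d j) * axis_coeff k (-1) 0 (2*n+1) (2*j))
     = (\<Sum>j=0..n+1. pochhammer b j * pochhammer (1/2) j / (pochhammer c j * pochhammer d j) * axis_coeff k (-1) 0 (2*n+1) (2*j))"
    by (simp add: axis_coeff_def) (simp add: gegenbauer_coeff_def binomial_eq_0)
  have "?L = (\<Sum>j\<le>n+1. g * (hyp_term (Suc n) a B c d j * (p + q * real j)))"
    unfolding last sum_split_0[of _ "n+1"] atLeast0AtMost[symmetric] zero add.assoc sum.distrib[symmetric]
    by (intro arg_cong2[of _ _ _ _ "(+)"] sum.cong refl summand) auto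
  also have "\<dots> = g * (\<Sum>j\<le>Suc n. hyp_term (Suc n) a B c d j * (p + q * real j))"
    by (simp only: sum_distrib_left Suc_eq_plus1)
  also have "(\<Sum>j\<le>Suc n. hyp_term (Suc n) a B c d j * (p + q * real j)) =
     pochhammer (c - a) n * pochhammer (d - a) n / (pochhammer c (Suc n) * pochhammer d (Suc n))
      * (p * ((c - a + real n) * (d - a + real n) + (real n + 1) * a) - q * (real n + 1) * a * B)"
    using assms by (intro saalschuetz_next) (auto simp: pochhammer_pos_ne B_def a_def)
  also have "q * (real n + 1) * a * B = M / a * (a * (M - B + d - 1))"
    using pos by (simp add: q_def M_def)
  also have "p * ((c - a + real n) * (d - a + real n) + (real n + 1) * a) - M / a * (a * (M - B + d - 1))
     = M / a * ((c - a + real n) * (d + real n))"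
    unfolding p_def right_diff_distrib[symmetric] B_def b a_def M_def by (simp add: algebra_simps)
  also have "g * (pochhammer (c - a) n * pochhammer (d - a) n / (pochhammer c (Suc n) * pochhammer d (Suc n)) * (M / a * ((c - a + real n) * (d + real n))))
    = - lead_factor (k+1) n * (pochhammer (c - a) (Suc n) * pochhammer (d - a) n / (pochhammer c (Suc n) * pochhammer d n))"
  proof -
    have "d + real n \<noteq> 0" using assms by linarith
    then show ?thesis unfolding gg pochhammer_Suc[of "c - a"] pochhammer_Suc[of d] by (simp add: mult_ac)
  qed
  finally show ?thesis by (simp add: a_def diff_diff_eq)
qed

text \<open>
  The shift \<open>j = i + 1\<close> turns \<open>(c)\<^sub>j\<close> into \<open>c (c + 1)\<^sub>i\<close>, which gives a balanced sum with lower
  parameters \<open>c + 1\<close> and \<open>d\<close>.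
\<close>

lemma psi_odd_diff_sum:
  assumes "c > 0" "d > 0" and b: "b = c + d - k - 1"
  shows "(\<Sum>j=1..n+1. pochhammer b (j-1) * pochhammer (1/2) j / (pochhammer c j * pochhammer d (j-1)) * axis_coeff k 0 (-1) (2*n+1) (2*j-1))
    = (k + real n + 1/2) * lead_factor (k+1) n * (pochhammer (c - k - real n) n * pochhammer (d - k - 1 - real n) n / (pochhammer c (n+1) * pochhammer d n))"
proof -
  define a where "a = k + 1 + real n"
  have "pochhammer b i * pochhammer (1/2) (Suc i) / (pochhammer c (Suc i) * pochhammer d i) * axis_coeff k 0 (-1) (Suc (2*n)) (Suc (2*i))
    = (k + real n + 1/2) * lead_factor (k+1) n / c * hyp_term n a b (c + 1) d i" for i
  proof -
    have "pochhammer b i * pochhammer (1/2) (Suc i) / (pochhammer c (Suc i) * pochhammer d i) * axis_coeff k 0 (-1) (Suc (2*n)) (Suc (2*i))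
      = pochhammer b i / (c * pochhammer (c + 1) i * pochhammer d i) * (pochhammer (1/2) (Suc i) * axis_coeff k 0 (-1) (Suc (2*n)) (Suc (2*i)))"
      unfolding pochhammer_rec[of c] by simp
    then show ?thesis unfolding gegenbauer_coeff_odd_diff hyp_term_def a_def by (simp add: mult_ac)
  qed
  then have "(\<Sum>j=1..n+1. pochhammer b (j-1) * pochhammer (1/2) j / (pochhammer c j * pochhammer d (j-1)) * axis_coeff k 0 (-1) (2*n+1) (2*j-1))
    = (k + real n + 1/2) * lead_factor (k+1) n / c * (\<Sum>i\<le>n. hyp_term n a b (c + 1) d i)"
    unfolding One_nat_def add_Suc_right add_0_right sum.atLeast_Suc_atMost_Suc_shift atLeast0AtMost sum_distrib_left
    by (intro sum.cong refl) simp
  also have "b = (c + 1) + d - a + real n - 1" by (simp add: b a_def)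
  then have "(\<Sum>i\<le>n. hyp_term n a b (c + 1) d i) = pochhammer (c + 1 - a) n * pochhammer (d - a) n / (pochhammer (c + 1) n * pochhammer d n)"
    using saalschuetz[of "c + 1" n d a] assms(1,2) by (simp add: pochhammer_pos_ne)
  also have "c + 1 - a = c - k - real n" by (simp add: a_def)
  also have "d - a = d - k - 1 - real n" by (simp add: a_def)
  finally show ?thesis by (simp add: pochhammer_rec[of c] mult.assoc del: sum.cl_ivl_Suc)
qed


section \<open>The coefficients of the polynomials h\<close>

lemma lead_factor_times:
  "lead_factor (k+1) n * (x * y / (u * v)) = (-1)^n * pochhammer (k+1) n * x * y / (fact n * u * v)"
  by (simp add: lead_factor_def)

context
  fixes N n :: nat and k k1 k2 :: real
  assumes N: "N \<ge> 2" and k: "k > 0" and k1: "k1 > 0"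
    and k2: "k2 = (real N - 1) * k + k1 + 1/2"
begin

lemma params:
  "(real N - 1) * k + k1 + 1/2 + real n = k2 + real n"
  "(real N - 1) * k + k1 + 3/2 + real n = k2 + real n + 1"
  "(real N - 1) * k + k1 + 5/2 + real n = k2 + real n + 2"
  "k2 - k > 0" "k2 > 0" "real N * k > 0"
proof -
  have "real N - 1 \<ge> 1" using N by linarith
  then have "(real N - 1) * k \<ge> 1 * k" using k by (intro mult_right_mono) auto
  then show "k2 - k > 0" "k2 > 0" unfolding k2 using k k1 by linarith+
  show "real N * k > 0" using N k by simp
qed (simp_all add: k2)

text \<open>
  With \<open>c = k\<^sub>2 + n\<close> and \<open>d = Nk + n + 1\<close> the remaining parameter in the definition is the balanced one,
  \<open>c - a\<close> is \<open>k\<^sub>2 - k\<close> and \<open>d - a\<close> is \<open>(N - 1)k + 1\<close>, independently of \<open>n\<close>. The other three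
  polynomials built from \<open>\<phi>\<close> follow the same pattern with \<open>c\<close> or \<open>d\<close> increased and, for the odd
  \<open>t\<close>-degree, with \<open>a = k + 1 + n\<close>.
\<close>

lemma h_4n_0_values:
  defines "V \<equiv> (-1)^n * pochhammer (k + 1) n * pochhammer (k2 - k) n * pochhammer ((real N - 1) * k + 1) n
        / (fact n * pochhammer (k2 + real n) n * pochhammer (real N * k + real n + 1) n)"
  shows "cof (h_4n_0 N k k1 n) (4*n) 0 = V" "cof (h_4n_0 N k k1 n) 0 (4*n) = V"
    "eval (h_4n_0 N k k1 n) e1 = V"
proof -
  have e: "4 * n = 2 * (2 * n)" by simp
  have c: "k2 + real n > 0" and d: "real N * k + real n + 1 > 0"
    using params by (auto intro: add_pos_nonneg)
  have b: "2 * (real N - 1) * k + k1 + 1/2 + 2 * real n = (k2 + real n) + (real N * k + real n + 1) - k - 1"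
    by (simp add: k2 algebra_simps)
  have x: "k2 + real n - k - real n = k2 - k" "real N * k + real n + 1 - k - real n = (real N - 1) * k + 1"
    by (simp_all add: algebra_simps)
  note S = phi_even_sum[OF c d b, where n = n, unfolded x lead_factor_times, folded V_def]
  show "cof (h_4n_0 N k k1 n) (4*n) 0 = V" "cof (h_4n_0 N k k1 n) 0 (4*n) = V"
    "eval (h_4n_0 N k k1 n) e1 = V"
    unfolding h_4n_0_def cof_sum cof_Const_mult eval_e1_sum e cof_phi[OF N] params(1) by (simp_all only: S)
qed

lemma h_4n1_1_values:
  defines "V \<equiv> (-1)^n * pochhammer (k + 1) n * pochhammer (k2 + 1 - k) n * pochhammer ((real N - 1) * k + 1) n
        / (fact n * pochhammer (k2 + real n + 1) n * pochhammer (real N * k + real n + 1) n)"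
  shows "cof (h_4n1_1 N k k1 n) (4*n+1) 1 = V" "cof (h_4n1_1 N k k1 n) 1 (4*n+1) = V"
proof -
  have e: "4 * n + 1 = Suc (2 * (2 * n))" "1 = Suc 0" by simp_all
  have c: "k2 + real n + 1 > 0" and d: "real N * k + real n + 1 > 0"
    using params by (auto intro: add_pos_nonneg)
  have b: "2 * (real N - 1) * k + k1 + 3/2 + 2 * real n = (k2 + real n + 1) + (real N * k + real n + 1) - k - 1"
    by (simp add: k2 algebra_simps)
  have x: "k2 + real n + 1 - k - real n = k2 + 1 - k" "real N * k + real n + 1 - k - real n = (real N - 1) * k + 1"
    by (simp_all add: algebra_simps)
  note S = phi_even_sum[OF c d b, where n = n, unfolded x lead_factor_times, folded V_def]
  have "cof (h_4n1_1 N k k1 n) (Suc (2 * (2 * n))) (Suc 0) = V" "cof (h_4n1_1 N k k1 n) (Suc 0) (Suc (2 * (2 * n))) = V"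
    unfolding h_4n1_1_def mult.assoc[of "X 1"] cof_X1 cof_X2 cof_sum cof_Const_mult cof_phi[OF N] params(2) by (simp_all only: S)
  then show "cof (h_4n1_1 N k k1 n) (4*n+1) 1 = V" "cof (h_4n1_1 N k k1 n) 1 (4*n+1) = V"
    by simp_all
qed

lemma h_4n2_0_values:
  defines "V \<equiv> (-1)^n * pochhammer (k + 1) n * pochhammer (k2 - k) n * pochhammer ((real N - 1) * k + 1) n
        / (fact n * pochhammer (k2 + real n + 1) n * pochhammer (real N * k + real n + 2) n)"
  shows "cof (h_4n2_0 N k k1 n) (4*n+2) 0 = V" "cof (h_4n2_0 N k k1 n) 0 (4*n+2) = - V"
    "eval (h_4n2_0 N k k1 n) e1 = V"
proof -
  have e: "4 * n + 2 = 2 * (2 * n + 1)" by simp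
  have c: "k2 + real n + 1 > 0" and d: "real N * k + real n + 2 > 0"
    using params by (auto intro: add_pos_nonneg)
  have b: "2 * (real N - 1) * k + k1 + 3/2 + 2 * real n = (k2 + real n + 1) + (real N * k + real n + 2) - k - 2"
    by (simp add: k2 algebra_simps)
  have x: "k2 + real n + 1 - k - 1 - real n = k2 - k" "real N * k + real n + 2 - k - 1 - real n = (real N - 1) * k + 1"
    by (simp_all add: algebra_simps)
  note S = phi_odd_sum[OF c d b, where n = n, unfolded x mult.assoc[of _ "lead_factor (k+1) n"] lead_factor_times, folded V_def]
  show "cof (h_4n2_0 N k k1 n) (4*n+2) 0 = V" "cof (h_4n2_0 N k k1 n) 0 (4*n+2) = - V"
    "eval (h_4n2_0 N k k1 n) e1 = V"
    unfolding h_4n2_0_def cof_sum cof_Const_mult eval_e1_sum e cof_phi[OF N] params(2) S by simp_all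
qed

lemma h_4n3_1_values:
  defines "V \<equiv> (-1)^n * pochhammer (k + 1) n * pochhammer (k2 + 1 - k) n * pochhammer ((real N - 1) * k + 1) n
        / (fact n * pochhammer (k2 + real n + 2) n * pochhammer (real N * k + real n + 2) n)"
  shows "cof (h_4n3_1 N k k1 n) (4*n+3) 1 = V" "cof (h_4n3_1 N k k1 n) 1 (4*n+3) = - V"
proof -
  have e: "4 * n + 3 = Suc (2 * (2 * n + 1))" "1 = Suc 0" by simp_all
  have c: "k2 + real n + 2 > 0" and d: "real N * k + real n + 2 > 0"
    using params by (auto intro: add_pos_nonneg)
  have b: "2 * (real N - 1) * k + k1 + 5/2 + 2 * real n = (k2 + real n + 2) + (real N * k + real n + 2) - k - 2"
    by (simp add: k2 algebra_simps)
  have x: "k2 + real n + 2 - k - 1 - real n = k2 + 1 - k" "real N * k + real n + 2 - k - 1 - real n = (real N - 1) * k + 1"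
    by (simp_all add: algebra_simps)
  note S = phi_odd_sum[OF c d b, where n = n, unfolded x mult.assoc[of _ "lead_factor (k+1) n"] lead_factor_times, folded V_def]
  have "cof (h_4n3_1 N k k1 n) (Suc (2 * (2 * n + 1))) (Suc 0) = V" "cof (h_4n3_1 N k k1 n) (Suc 0) (Suc (2 * (2 * n + 1))) = - V"
    unfolding h_4n3_1_def mult.assoc[of "X 1"] cof_X1 cof_X2 cof_sum cof_Const_mult cof_phi[OF N] params(3) S by simp_all
  then show "cof (h_4n3_1 N k k1 n) (4*n+3) 1 = V" "cof (h_4n3_1 N k k1 n) 1 (4*n+3) = - V"
    by (simp_all only: e)
qed

text \<open>
  On the second axis the coefficient is \<open>2 V0 - V\<close>, where \<open>V0\<close> comes from the balanced sum for
  \<open>(\<alpha>, \<beta>) = (0, -1)\<close>; in that case the terms of odd \<open>s\<close>-degree vanish.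
\<close>

lemma h_4n1_0_values:
  defines "V \<equiv> (-1)^n * pochhammer (k + 1) n * pochhammer (k2 - k) n * pochhammer ((real N - 1) * k + 1) n
        / (fact n * pochhammer (k2 + real n + 1) n * pochhammer (real N * k + real n + 1) n)"
  shows "cof (h_4n1_0 N k k1 n) (4*n+1) 0 = V"
    "cof (h_4n1_0 N k k1 n) 1 (4*n) = V * ((k2 - k + 2 * real n) / (k2 - k))"
proof -
  define b c d where "b = 2 * (real N - 1) * k + k1 + 3/2 + 2 * real n"
    and "c = k2 + real n + 1" and "d = real N * k + real n + 1"
  have e: "4 * n + 1 = Suc (2 * (2 * n))" "4 * n = 2 * (2 * n)" "1 = Suc 0" by simp_all
  have c: "c > 1" "c > 0" and d: "d > 0" and cd: "c + d - k - 2 > 0"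
    using params by (auto simp: c_def d_def intro: add_pos_nonneg)
  have b: "b = c + d - k - 1"
    by (simp add: b_def c_def d_def k2 algebra_simps)
  have x: "c - k - real n = k2 - k + 1" "c - k - real n - 1 = k2 - k" "d - k - real n = (real N - 1) * k + 1"
    by (simp_all add: c_def d_def algebra_simps)
  define w where "w j = pochhammer b j * pochhammer (1/2) j / (pochhammer c j * pochhammer d j)" for j
  define v where "v j = pochhammer b (j-1) * pochhammer (1/2) j / (pochhammer c (j-1) * pochhammer d j)" for j
  note h = h_4n1_0_def[of N k k1 n, unfolded params(2), folded b_def c_def d_def, folded w_def v_def]
  have S1: "(\<Sum>j=0..n. w j * axis_coeff k (-1) 0 (2*n) (2*j)) + (\<Sum>j=1..n. v j * axis_coeff k (-1) 0 (2*n) (2*j-1)) = V"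
    unfolding w_def v_def psi_even_sum[OF c(1) d k cd b, of n] x
    by (simp add: V_def c_def d_def lead_factor_def)
  define V0 where "V0 = (-1)^n * pochhammer (k + 1) n * pochhammer (k2 - k + 1) n * pochhammer ((real N - 1) * k + 1) n
        / (fact n * pochhammer c n * pochhammer d n)"
  have S2: "(\<Sum>j=0..n. w j * axis_coeff k 0 (-1) (2*n) (2*j)) = V0"
    using phi_even_sum[OF c(2) d b, of 0 n] unfolding x lead_factor_times w_def V0_def by simp
  have S3: "axis_coeff k 0 (-1) (2*n) (2*j-1) = 0" if "j \<ge> 1" for j
    using that by (cases j) (auto simp: axis_coeff_def gegenbauer_coeff_def)
  have S3: "(\<Sum>j=1..n. v j * axis_coeff k 0 (-1) (2*n) (2*j-1)) = 0"
    by (intro sum.neutral ballI) (simp only: S3 mult_zero_right atLeastAtMost_iff)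
  have "cof (h_4n1_0 N k k1 n) (Suc (2 * (2 * n))) 0 = V"
    unfolding h cof_add cof_sum cof_Const_mult cof_psi[OF N] by (rule S1)
  then show "cof (h_4n1_0 N k k1 n) (4*n+1) 0 = V" by simp
  have "cof (h_4n1_0 N k k1 n) (Suc 0) (2 * (2 * n)) =
      2 * (\<Sum>j=0..n. w j * axis_coeff k 0 (-1) (2*n) (2*j)) + 2 * (\<Sum>j=1..n. v j * axis_coeff k 0 (-1) (2*n) (2*j-1))
      - ((\<Sum>j=0..n. w j * axis_coeff k (-1) 0 (2*n) (2*j)) + (\<Sum>j=1..n. v j * axis_coeff k (-1) 0 (2*n) (2*j-1)))"
    unfolding h cof_add cof_sum cof_Const_mult cof_psi[OF N] axis_coeff_psi_sum
    by (simp add: right_diff_distrib sum_subtractf sum_distrib_left mult.left_commute)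
  also note S1
  also note S2
  also note S3
  also have "V0 = V * ((k2 - k + real n) / (k2 - k))"
  proof -
    have "pochhammer (k2 - k + 1) n = pochhammer (k2 - k) n * ((k2 - k + real n) / (k2 - k))"
      using pochhammer_shift[of "k2 - k" n] params(4) by (simp add: field_simps)
    then show ?thesis by (simp add: V0_def V_def c_def d_def mult_ac)
  qed
  also have "2 * (V * ((k2 - k + real n) / (k2 - k))) + 2 * 0 - V = V * ((k2 - k + 2 * real n) / (k2 - k))"
    using params(4) by (simp add: field_simps)
  finally show "cof (h_4n1_0 N k k1 n) 1 (4*n) = V * ((k2 - k + 2 * real n) / (k2 - k))"
    by (simp only: e)
qed

text \<open>
  As for \<open>h_4n1_0_values\<close>, but now the terms of even \<open>s\<close>-degree vanish for \<open>(\<alpha>, \<beta>) = (0, -1)\<close>.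
\<close>

lemma h_4n3_0_values:
  defines "V \<equiv> (-1)^(n+1) * pochhammer (k + 1) n * pochhammer (k2 - k) (n+1) * pochhammer ((real N - 1) * k + 1) n
        / (fact n * pochhammer (k2 + real n + 1) (n+1) * pochhammer (real N * k + real n + 2) n)"
  shows "cof (h_4n3_0 N k k1 n) (4*n+3) 0 = V"
    "cof (h_4n3_0 N k k1 n) 1 (4*n+2) = - V * ((k2 + k + 2 * real n + 1) / (k2 - k))"
proof -
  define b c d where "b = 2 * (real N - 1) * k + k1 + 5/2 + 2 * real n"
    and "c = k2 + real n + 1" and "d = real N * k + real n + 2"
  have e: "4 * n + 3 = Suc (2 * (2 * n + 1))" "4 * n + 2 = 2 * (2 * n + 1)" "1 = Suc 0" by simp_all
  have c: "c > 1" "c > 0" and d: "d > 0" and cd: "c + d - k - 2 > 0"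
    using params by (auto simp: c_def d_def intro: add_pos_nonneg)
  have b: "b = c + d - k - 1"
    by (simp add: b_def c_def d_def k2 algebra_simps)
  have x: "c - k - real n = k2 - k + 1" "c - k - 1 - real n = k2 - k" "d - k - 1 - real n = (real N - 1) * k + 1"
    by (simp_all add: c_def d_def algebra_simps)
  define w where "w j = pochhammer b j * pochhammer (1/2) j / (pochhammer c j * pochhammer d j)" for j
  define v where "v j = pochhammer b (j-1) * pochhammer (1/2) j / (pochhammer c j * pochhammer d (j-1))" for j
  note h = h_4n3_0_def[of N k k1 n, unfolded params(2), folded b_def c_def d_def, folded w_def v_def]
  have S1: "(\<Sum>j=0..n. w j * axis_coeff k (-1) 0 (2*n+1) (2*j)) + (\<Sum>j=1..n+1. v j * axis_coeff k (-1) 0 (2*n+1) (2*j-1)) = V"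
    unfolding w_def v_def psi_odd_sum[OF c(1) d k cd b, of n] x
    by (simp add: V_def c_def d_def lead_factor_def)
  define V0 where "V0 = (-1)^n * pochhammer (k + 1) n * pochhammer (k2 - k + 1) n * pochhammer ((real N - 1) * k + 1) n
        / (fact n * pochhammer c (n+1) * pochhammer d n)"
  have S2: "(\<Sum>j=1..n+1. v j * axis_coeff k 0 (-1) (2*n+1) (2*j-1)) = (k + real n + 1/2) * V0"
    unfolding v_def psi_odd_diff_sum[OF c(2) d b, of n] x by (simp add: V0_def lead_factor_def)
  have S3: "axis_coeff k 0 (-1) (2*n+1) (2*j) = 0" for j
    by (cases j) (auto simp: axis_coeff_def gegenbauer_coeff_def)
  have S3: "(\<Sum>j=0..n. w j * axis_coeff k 0 (-1) (2*n+1) (2*j)) = 0"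
    by (intro sum.neutral ballI) (simp only: S3 mult_zero_right atLeastAtMost_iff)
  have "cof (h_4n3_0 N k k1 n) (Suc (2 * (2 * n + 1))) 0 = V"
    unfolding h cof_add cof_sum cof_Const_mult cof_psi[OF N] by (rule S1)
  then show "cof (h_4n3_0 N k k1 n) (4*n+3) 0 = V" by (simp only: e)
  have "cof (h_4n3_0 N k k1 n) (Suc 0) (2 * (2 * n + 1)) =
      2 * (\<Sum>j=0..n. w j * axis_coeff k 0 (-1) (2*n+1) (2*j)) + 2 * (\<Sum>j=1..n+1. v j * axis_coeff k 0 (-1) (2*n+1) (2*j-1))
      - ((\<Sum>j=0..n. w j * axis_coeff k (-1) 0 (2*n+1) (2*j)) + (\<Sum>j=1..n+1. v j * axis_coeff k (-1) 0 (2*n+1) (2*j-1)))"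
    unfolding h cof_add cof_sum cof_Const_mult cof_psi[OF N] axis_coeff_psi_sum
    by (simp add: right_diff_distrib sum_subtractf sum_distrib_left mult.left_commute del: sum.cl_ivl_Suc)
  also note S1
  also note S2
  also note S3
  also have "V0 = - V / (k2 - k)"
    using params(4) by (simp add: V0_def V_def c_def d_def pochhammer_rec[of "k2 - k"])
  also have "2 * 0 + 2 * ((k + real n + 1/2) * (- V / (k2 - k))) - V = - V * ((k2 + k + 2 * real n + 1) / (k2 - k))"
    using params(4) by (simp add: field_simps)
  finally show "cof (h_4n3_0 N k k1 n) 1 (4*n+2) = - V * ((k2 + k + 2 * real n + 1) / (k2 - k))"
    by (simp only: e)
qed

end



theorem mainTheorem3:
  fixes N n :: nat and k k1 k2 :: real
  assumes "N \<ge> 2" and "k > 0" and "k1 > 0"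
    and "k2 = (real N - 1) * k + k1 + 1/2"
  shows
    "(cof (h_4n_0 N k k1 n) (4*n) 0 = cof (h_4n_0 N k k1 n) 0 (4*n)
      \<and> cof (h_4n_0 N k k1 n) 0 (4*n) = eval (h_4n_0 N k k1 n) e1
      \<and> eval (h_4n_0 N k k1 n) e1 =
        (-1)^n * pochhammer (k + 1) n * pochhammer (k2 - k) n * pochhammer ((real N - 1) * k + 1) n
        / (fact n * pochhammer (k2 + real n) n * pochhammer (real N * k + real n + 1) n))
     \<and> (cof (h_4n1_1 N k k1 n) (4*n+1) 1 = cof (h_4n1_1 N k k1 n) 1 (4*n+1)
      \<and> cof (h_4n1_1 N k k1 n) 1 (4*n+1) =
        (-1)^n * pochhammer (k + 1) n * pochhammer (k2 + 1 - k) n * pochhammer ((real N - 1) * k + 1) n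
        / (fact n * pochhammer (k2 + real n + 1) n * pochhammer (real N * k + real n + 1) n))
     \<and> (cof (h_4n2_0 N k k1 n) (4*n+2) 0 = - cof (h_4n2_0 N k k1 n) 0 (4*n+2)
      \<and> - cof (h_4n2_0 N k k1 n) 0 (4*n+2) = eval (h_4n2_0 N k k1 n) e1
      \<and> eval (h_4n2_0 N k k1 n) e1 =
        (-1)^n * pochhammer (k + 1) n * pochhammer (k2 - k) n * pochhammer ((real N - 1) * k + 1) n
        / (fact n * pochhammer (k2 + real n + 1) n * pochhammer (real N * k + real n + 2) n))
     \<and> (cof (h_4n3_1 N k k1 n) (4*n+3) 1 = - cof (h_4n3_1 N k k1 n) 1 (4*n+3)
      \<and> - cof (h_4n3_1 N k k1 n) 1 (4*n+3) =
        (-1)^n * pochhammer (k + 1) n * pochhammer (k2 + 1 - k) n * pochhammer ((real N - 1) * k + 1) n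
        / (fact n * pochhammer (k2 + real n + 2) n * pochhammer (real N * k + real n + 2) n))
     \<and> (cof (h_4n1_0 N k k1 n) (4*n+1) 0 =
        (-1)^n * pochhammer (k + 1) n * pochhammer (k2 - k) n * pochhammer ((real N - 1) * k + 1) n
        / (fact n * pochhammer (k2 + real n + 1) n * pochhammer (real N * k + real n + 1) n))
     \<and> (cof (h_4n1_0 N k k1 n) 1 (4*n) =
        cof (h_4n1_0 N k k1 n) (4*n+1) 0 * ((k2 - k + 2 * real n) / (k2 - k)))
     \<and> (cof (h_4n3_0 N k k1 n) (4*n+3) 0 =
        (-1)^(n+1) * pochhammer (k + 1) n * pochhammer (k2 - k) (n+1) * pochhammer ((real N - 1) * k + 1) n
        / (fact n * pochhammer (k2 + real n + 1) (n+1) * pochhammer (real N * k + real n + 2) n))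
     \<and> (cof (h_4n3_0 N k k1 n) 1 (4*n+2) =
        - cof (h_4n3_0 N k k1 n) (4*n+3) 0 * ((k2 + k + 2 * real n + 1) / (k2 - k)))"
  using h_4n_0_values[OF assms, of n] h_4n1_1_values[OF assms, of n] h_4n2_0_values[OF assms, of n]
    h_4n3_1_values[OF assms, of n] h_4n1_0_values[OF assms, of n] h_4n3_0_values[OF assms, of n]
  by (simp only: minus_minus simp_thms)

end
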